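(* Let $k\ge 3$ be an integer. (1) If $0<|z|\le e^{-k/2}$, then $$\rho_{0,k+1}(z)=\frac{\left(\log\frac{1}{|z|^2}\right)^{k+1}|z|^2}{2\pi (k-1)!}\,(1+\epsilon_1),\qquad\text{where } 0<\epsilon_1\le 2^{k+1}|z|^2 .$$ (2) Let $b\ge 2$ be an integer such that $\frac{k}{b(b+1)}\ge \log 2$. If $|z|=e^{-k/(2b)}$, then $$\rho_{0,k+1}(z)=\frac{k^{k+1}e^{-k}}{2b\pi (k-1)!}\,(1+\epsilon_b),$$ where $$\left(1+\tfrac1b\right)^k e^{-k/b}+\left(1-\tfrac1b\right)^k e^{k/b}<\epsilon_b<2\left[\left(1+\tfrac1b\right)^k e^{-k/b}+\left(1-\tfrac1b\right)^k e^{k/b}\right].$$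
   Context: For an integer $k\ge 2$, $\rho_{0,k}$ denotes the Bergman kernel function of the punctured unit disk $\mathbb D^*=\{z\in\mathbb C: 0<|z|<1\}$ with the Poincaré metric $\omega=\frac{i\,dz\wedge d\bar z}{|z|^2(\log\frac1{|z|^2})^2}$, i.e. of the Hilbert space $\mathcal H_{0,k}$ of holomorphic functions $f$ on $\mathbb D^*$ with $\int_{\mathbb D^*}|f|^2(\log\frac{1}{|z|^2})^k\,\omega<\infty$: $\rho_{0,k}=(\log\frac1{|z|^2})^k\sum_i|f_i|^2$ for an orthonormal basis $(f_i)$. Explicitly, $$\rho_{0,k}(z)=\frac{(\log \frac{1}{|z|^2})^k}{2\pi (k-2)!}\sum_{a=1}^{\infty}a^{k-1}|z|^{2a}.$$ *)

theory Defs
  imports "HOL-Complex_Analysis.Complex_Analysis"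
begin

definition punctured_disc :: "complex set" where
  "punctured_disc = {z. 0 < cmod z \<and> cmod z < 1}"

definition log_weight :: "complex \<Rightarrow> real" where
  "log_weight z = ln (1 / (cmod z)\<^sup>2)"

text \<open>The measure of the Poincare form
  \<open>\<omega> = i dz \<and> d(cnj z) / (|z|\<^sup>2 (log (1 / |z|\<^sup>2))\<^sup>2)\<close> on the punctured disc, extended by zero.
  The factor 2 comes from \<open>i dz \<and> d(cnj z) = 2 dx \<and> dy\<close>.\<close>

definition poincare_measure :: "complex measure" where
  "poincare_measure = density lborel
     (\<lambda>z. ennreal (indicator punctured_disc z * (2 / ((cmod z)\<^sup>2 * (log_weight z)\<^sup>2))))"

text \<open>Functions on the punctured disc are represented by total functions whose values
  elsewhere are irrelevant; hence the set integrals below.\<close>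

definition bergman_space :: "nat \<Rightarrow> (complex \<Rightarrow> complex) set" where
  "bergman_space k = {f. f holomorphic_on punctured_disc \<and>
     set_integrable poincare_measure punctured_disc (\<lambda>z. (cmod (f z))\<^sup>2 * log_weight z ^ k)}"

definition bergman_inner ::
  "nat \<Rightarrow> (complex \<Rightarrow> complex) \<Rightarrow> (complex \<Rightarrow> complex) \<Rightarrow> complex" where
  "bergman_inner k f g =
     (LINT z:punctured_disc|poincare_measure. f z * cnj (g z) * of_real (log_weight z ^ k))"

definition bergman_norm :: "nat \<Rightarrow> (complex \<Rightarrow> complex) \<Rightarrow> real" where
  "bergman_norm k f =
     sqrt (LINT z:punctured_disc|poincare_measure. (cmod (f z))\<^sup>2 * log_weight z ^ k)"

text \<open>An orthonormal (Hilbert) basis: an orthonormal family with dense linear span. The index set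
  can be taken to be the naturals because, for \<open>k \<ge> 2\<close>, the space is separable and
  infinite-dimensional.\<close>

definition bergman_onb :: "nat \<Rightarrow> (nat \<Rightarrow> complex \<Rightarrow> complex) \<Rightarrow> bool" where
  "bergman_onb k f \<longleftrightarrow>
     (\<forall>i. f i \<in> bergman_space k) \<and>
     (\<forall>i j. bergman_inner k (f i) (f j) = (if i = j then 1 else 0)) \<and>
     (\<forall>g\<in>bergman_space k. \<forall>e>0. \<exists>n c.
        bergman_norm k (\<lambda>z. g z - (\<Sum>i<n. c i * f i z)) < e)"

text \<open>For \<open>z\<close> in the punctured disc and \<open>k \<ge> 2\<close>, the value does not depend on the chosen
  orthonormal basis.\<close>

definition bergman_kernel_fun :: "nat \<Rightarrow> complex \<Rightarrow> real" where
  "bergman_kernel_fun k z =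
     (let f = (SOME f. bergman_onb k f)
      in log_weight z ^ k * (\<Sum>i. (cmod (f i z))\<^sup>2))"

end

theory Submission
  imports Defs "HOL-Probability.Distributions"
begin

text \<open>For any orthonormal basis \<open>f\<close>, the sum \<open>\<Sum>i. |f i z|\<^sup>2\<close> is the best constant in the evaluation
  estimate at \<open>z\<close>, so it can be computed from one basis. The normalised powers \<open>z ^ n\<close> with
  \<open>n \<ge> 1\<close> are one: by the area mean value property a function of the space tends to \<open>0\<close> at the
  puncture, hence extends holomorphically with a zero there; Bessel's inequality and Fatou's lemma
  show that its Taylor series converges in norm. All integrals are evaluated by rotation invariance
  of Lebesgue measure, which turns them into Cauchy integrals over circles, and by the fact that
  \<open>log (1 / |z|\<^sup>2)\<close> is exponentially distributed on the disc.

  For the resulting series \<open>\<Sum>a\<ge>1. a\<^sup>k |z|\<^sup>2\<^sup>a\<close>, consecutive terms shrink by a factor of more than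
  two away from the dominant index \<open>b\<close>, because \<open>(1 + 1/a)\<^sup>k |z|\<^sup>2 < exp (k/a - k/b)\<close> and
  \<open>k / (b (b + 1)) \<ge> log 2\<close>; in the first part the same holds with \<open>b = 1\<close>.\<close>

section \<open>The dominant term of the kernel series\<close>

lemma one_plus_power_less_exp:
  fixes x :: real
  assumes "0 < x" "0 < k"
  shows "(1 + x) ^ k < exp (real k * x)"
proof -
  have "1 + x < exp x"
    using assms exp_ge_add_one_self[of x] ln_add_one_self_less_self[of x]
    by (metis add_pos_pos ln_less_cancel_iff exp_gt_zero ln_exp zero_less_one)
  then have "(1 + x) ^ k < exp x ^ k"
    using assms by (intro power_strict_mono) auto
  then show ?thesis
    by (simp add: exp_of_nat_mult)
qed

text \<open>Comparison with a geometric series of ratio 1/2. For the upper bound, summing the strict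
  inequalities puts the tail below half of the whole sum, and the tail is the sum minus
  \<open>f 0\<close>.\<close>

lemma suminf_halving:
  fixes f :: "nat \<Rightarrow> real"
  assumes pos: "\<And>n. 0 < f n" and half: "\<And>n. f (Suc n) < f n / 2"
  shows "summable f" "f 0 < suminf f" "suminf f < 2 * f 0"
proof -
  show sm: "summable f"
    by (rule summable_ratio_test[of "1/2" 0]) (use pos half in \<open>auto simp: abs_of_pos less_imp_le\<close>)
  have sm': "summable (\<lambda>n. f (Suc n))"
    using sm summable_Suc_iff by blast
  have split: "suminf f = f 0 + (\<Sum>n. f (Suc n))"
    using suminf_split_head[OF sm] by simp
  have "0 < (\<Sum>n. f (Suc n))"
    by (rule suminf_pos[OF sm' pos])
  then show "f 0 < suminf f"
    using split by simp
  have "0 < (\<Sum>n. f n / 2 - f (Suc n))"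
    using half by (intro suminf_pos summable_diff sm' summable_divide sm) (auto simp: less_diff_eq)
  also have "\<dots> = suminf f / 2 - (\<Sum>n. f (Suc n))"
    by (simp add: suminf_diff[symmetric] suminf_divide sm sm' summable_divide)
  finally show "suminf f < 2 * f 0"
    using split by simp
qed

text \<open>Counterpart of the halving estimate for the terms below the peak. Each step of the
  induction absorbs the previous bound \<open>2 * f m\<close> into one copy of
  \<open>f (Suc m)\<close>.\<close>

lemma sum_doubling_le:
  fixes f :: "nat \<Rightarrow> real"
  assumes "\<And>a. a < m \<Longrightarrow> f a \<le> f (Suc a) / 2" and "0 \<le> f 0"
  shows "(\<Sum>a\<le>m. f a) \<le> 2 * f m"
  using assms
proof (induction m)
  case (Suc m)
  then have "(\<Sum>a\<le>m. f a) \<le> 2 * f m" "f m \<le> f (Suc m) / 2" by auto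
  then show ?case by simp
qed simp

text \<open>The ratio of consecutive terms is \<open>(1 + 1/a) ^ k * q\<close>, below exp (k/a -
  k/b). Since a is at least b + 1, the exponent is at most -k / (b (b + 1)), hence at most -ln 2.
  Only an upper bound on q enters, so with b = 1 a whole range of radii is covered.\<close>

lemma power_term_step:
  fixes k a b :: nat and q :: real
  assumes "0 < k" "1 \<le> b" "b < a" "0 < q" "q \<le> exp (- real k / real b)"
    "ln 2 \<le> real k / (real b * (real b + 1))"
  shows "real (Suc a) ^ k * q ^ Suc a < real a ^ k * q ^ a / 2"
proof -
  have a: "0 < a" using assms by simp
  have "(1 + 1 / real a) ^ k * q < exp (real k * (1 / real a)) * exp (- real k / real b)"
    using one_plus_power_less_exp[of "1 / real a" k] assms a
    by (intro mult_less_le_imp_less) auto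
  also have "\<dots> = exp (real k * (1 / real a) - real k / real b)"
    by (simp add: exp_diff exp_minus field_simps)
  also have "\<dots> \<le> exp (- (real k / (real b * (real b + 1))))"
  proof -
    have "real k * (1 / real a) \<le> real k * (1 / (real b + 1))"
      using assms by (intro mult_left_mono divide_left_mono) auto
    moreover have "real k * (1 / (real b + 1)) - real k / real b = - (real k / (real b * (real b + 1)))"
      using assms by (simp add: field_simps)
    ultimately show ?thesis by simp
  qed
  also have "\<dots> \<le> exp (- ln 2)"
    using assms by simp
  finally have "(1 + 1 / real a) ^ k * q < 1 / 2"
    by (simp add: exp_minus)
  then have "(1 + 1 / real a) ^ k * q * (real a ^ k * q ^ a) < 1 / 2 * (real a ^ k * q ^ a)"
    using a assms by (intro mult_strict_right_mono) auto
  moreover have "(1 + 1 / real a) ^ k * real a ^ k = real (Suc a) ^ k"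
    using a by (simp add: power_mult_distrib[symmetric] field_simps)
  ultimately show ?thesis
    by (simp add: mult.assoc mult.left_commute mult.commute)
qed

text \<open>Now the ratio is taken downwards: a / (a + 1) is at most exp (-1 / (a + 1)), and a + 1
  being at most b - 1 gives k / (a + 1) - k/b at least k / (b (b - 1)), hence at least ln 2. The
  remaining factor exp (-k/b) is exactly q.\<close>

lemma power_term_step_below:
  fixes k a b :: nat
  assumes "0 < k" "0 < a" "Suc a < b"
    "ln 2 \<le> real k / (real b * (real b + 1))"
  defines "q \<equiv> exp (- real k / real b)"
  shows "real a ^ k * q ^ a \<le> real (Suc a) ^ k * q ^ Suc a / 2"
proof -
  have "(real a / real (Suc a)) ^ k \<le> exp (- 1 / real (Suc a)) ^ k"
    using exp_ge_add_one_self[of "- 1 / real (Suc a)"]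
    by (intro power_mono) (auto simp: field_simps)
  also have "\<dots> = exp (- real k / real (Suc a))"
    by (simp add: exp_of_nat_mult[symmetric])
  also have "\<dots> \<le> exp (- real k / real b - ln 2)"
  proof -
    have "real k / real (Suc a) \<ge> real k / (real b - 1)"
      using assms by (intro divide_left_mono) auto
    moreover have "real k / (real b - 1) - real k / real b = real k / (real b * (real b - 1))"
      using assms by (simp add: field_simps)
    moreover have "real k / (real b * (real b + 1)) \<le> real k / (real b * (real b - 1))"
      using assms by (intro divide_left_mono mult_left_mono mult_pos_pos) auto
    ultimately show ?thesis using assms(4) by simp
  qed
  also have "\<dots> = q / 2"
    by (simp add: q_def exp_diff)
  finally have "(real a / real (Suc a)) ^ k * (real (Suc a) ^ k * q ^ a) \<le> q / 2 * (real (Suc a) ^ k * q ^ a)"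
    by (intro mult_right_mono) (auto simp: q_def)
  moreover have "(real a / real (Suc a)) ^ k * real (Suc a) ^ k = real a ^ k"
    by (simp add: power_mult_distrib[symmetric])
  ultimately show ?thesis
    by (simp add: mult.assoc mult.left_commute mult.commute)
qed

text \<open>The term of index 1 is q itself. The error is the sum of all later terms divided by q,
  and by halving that sum is less than twice the term of index 2, which is 2^k q^2.\<close>

lemma power_series_first_term:
  fixes k :: nat and q :: real
  assumes "3 \<le> k" "0 < q" "q \<le> exp (- real k)"
  shows "\<exists>\<epsilon>>0. \<epsilon> \<le> 2 ^ (k + 1) * q \<and> (\<Sum>n. real (Suc n) ^ k * q ^ Suc n) = q * (1 + \<epsilon>)"
proof -
  define f where "f n = real (n + 2) ^ k * q ^ (n + 2)" for n
  \<comment> \<open>For b = 1 the gap condition reads ln 2 <= k/2, which follows from k >=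
    3.\<close>
  have "ln (2::real) \<le> 1" using ln_le_minus_one[of 2] by simp
  then have "f (Suc n) < f n / 2" for n
    using power_term_step[of k 1 "n + 2" q] assms by (simp add: f_def)
  moreover have pos: "0 < f n" for n
    using assms by (simp add: f_def)
  ultimately have f: "summable f" "f 0 < suminf f" "suminf f < 2 * f 0"
    using suminf_halving[of f] by auto
  let ?T = "\<lambda>n. real (Suc n) ^ k * q ^ Suc n"
  have sm: "summable ?T"
    using f(1) unfolding f_def by (subst summable_iff_shift[of _ 1, symmetric]) simp
  have "suminf ?T = q + suminf f"
    using suminf_split_initial_segment[OF sm, of 1] by (simp add: f_def[abs_def])
  also have "\<dots> = q * (1 + suminf f / q)"
    using assms by (simp add: field_simps)
  finally have eq: "suminf ?T = q * (1 + suminf f / q)" .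
  have "f 0 = 2 ^ k * q * q"
    by (simp add: f_def power2_eq_square)
  then have "suminf f / q \<le> 2 ^ (k + 1) * q"
    using f(3) assms by (simp add: field_simps)
  moreover have "0 < suminf f / q"
    using f(2) pos[of 0] assms by simp
  ultimately show ?thesis using eq by blast
qed

text \<open>Divided by the term of index b, its neighbours of index b + 1 and b - 1 become the two
  summands of \<delta>. The terms above the peak and those below it each add up to something between
  the adjacent neighbour and its double; strictness comes from the infinite part.\<close>

lemma power_series_peak_term:
  fixes k b :: nat
  assumes "3 \<le> k" "2 \<le> b" "ln 2 \<le> real k / (real b * (real b + 1))"
  defines "q \<equiv> exp (- real k / real b)"
    and "\<delta> \<equiv> (1 + 1 / real b) ^ k * exp (- real k / real b) + (1 - 1 / real b) ^ k * exp (real k / real b)"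
  shows "\<exists>\<epsilon>. \<delta> < \<epsilon> \<and> \<epsilon> < 2 * \<delta> \<and>
    (\<Sum>n. real (Suc n) ^ k * q ^ Suc n) = real b ^ k * exp (- real k) * (1 + \<epsilon>)"
proof -
  define f where "f n = real (n + Suc b) ^ k * q ^ (n + Suc b)" for n
  have q: "0 < q" by (simp add: q_def)
  have "f (Suc n) < f n / 2" for n
    using power_term_step[of k b "n + Suc b" q] assms by (simp add: f_def)
  moreover have "0 < f n" for n
    using q by (simp add: f_def)
  ultimately have f: "summable f" "f 0 < suminf f" "suminf f < 2 * f 0"
    using suminf_halving[of f] by auto
  let ?T = "\<lambda>n. real (Suc n) ^ k * q ^ Suc n"
  have sm: "summable ?T"
    using f(1) unfolding f_def by (subst summable_iff_shift[of _ b, symmetric]) simp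
  \<comment> \<open>As \<open>?T n\<close> has index n + 1, \<open>?T (Suc m)\<close> is the peak
    and \<open>?T m\<close> its lower neighbour.\<close>
  obtain m where m: "b = m + 2" using assms by (metis le_add_diff_inverse2)
  define A where "A = (\<Sum>n\<le>m. ?T n)"
  have "A \<le> 2 * ?T m"
    unfolding A_def
  proof (rule sum_doubling_le)
    show "?T a \<le> ?T (Suc a) / 2" if "a < m" for a
      using power_term_step_below[of k "Suc a" b] assms that m by (simp add: q_def)
  qed (use q in auto)
  moreover have "?T m \<le> A"
    unfolding A_def using q by (intro member_le_sum) auto
  moreover have "suminf ?T = suminf f + (?T (Suc m) + A)"
  proof -
    have "suminf ?T = suminf f + (\<Sum>n<Suc (Suc m). ?T n)"
      using suminf_split_initial_segment[OF sm, of b] m by (simp add: f_def[abs_def])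
    moreover have "(\<Sum>n<Suc (Suc m). ?T n) = ?T (Suc m) + A"
      unfolding A_def lessThan_Suc_atMost[symmetric] by simp
    ultimately show ?thesis by simp
  qed
  moreover have mid: "?T (Suc m) = real b ^ k * exp (- real k)"
  proof -
    have "q ^ b = exp (- real k)"
      using assms by (simp add: q_def exp_of_nat_mult[symmetric])
    moreover have "Suc (Suc m) = b" using m by simp
    ultimately show ?thesis by (simp del: power_Suc)
  qed
  moreover define P where "P = real b ^ k * exp (- real k)"
  moreover have P: "0 < P" using assms by (simp add: P_def)
  moreover have "f 0 = P * ((1 + 1 / real b) ^ k * exp (- real k / real b))"
  proof -
    have "real (Suc b) ^ k = real b ^ k * (1 + 1 / real b) ^ k"
      using assms by (simp add: power_mult_distrib[symmetric] field_simps)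
    moreover have "q ^ Suc b = exp (- real k) * exp (- real k / real b)"
      unfolding q_def exp_of_nat_mult[symmetric] exp_add[symmetric] using assms by (simp add: field_simps)
    ultimately show ?thesis by (simp add: f_def P_def)
  qed
  moreover have "?T m = P * ((1 - 1 / real b) ^ k * exp (real k / real b))"
  proof -
    have "real (Suc m) ^ k = real b ^ k * (1 - 1 / real b) ^ k"
      using m by (simp add: power_mult_distrib[symmetric] field_simps)
    moreover have "q ^ Suc m = exp (- real k) * exp (real k / real b)"
      unfolding q_def exp_of_nat_mult[symmetric] exp_add[symmetric] using m by (simp add: field_simps)
    ultimately show ?thesis by (simp add: P_def)
  qed
  ultimately have "P * \<delta> < A + suminf f" "A + suminf f < 2 * (P * \<delta>)"
      "suminf ?T = P + (A + suminf f)"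
    using f by (auto simp: \<delta>_def distrib_left)
  moreover have "P + (A + suminf f) = P * (1 + (A + suminf f) / P)"
    using P by (simp add: field_simps)
  ultimately have "\<delta> < (A + suminf f) / P" "(A + suminf f) / P < 2 * \<delta>"
      "suminf ?T = P * (1 + (A + suminf f) / P)"
    using P by (simp_all only: pos_less_divide_eq pos_divide_less_eq ac_simps)
  then show ?thesis
    unfolding P_def by blast
qed

section \<open>Area integrals over the punctured disc\<close>

text \<open>Lebesgue measure is determined by its values on boxes. The preimage of a box is its
  image under the inverse map, which is again orthogonal and so preserves measure.\<close>

lemma distr_lborel_orthogonal_transformation:
  fixes T :: "real ^ 'n::{finite,wellorder} \<Rightarrow> real ^ 'n::_"
  assumes T: "orthogonal_transformation T"
  shows "distr lborel borel T = lborel"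
proof (rule sym, rule lborel_eqI)
  have bij: "bij T" and lin: "linear T"
    using T orthogonal_transformation_bij orthogonal_transformation_linear by auto
  have [measurable]: "T \<in> borel_measurable borel"
    using lin by (intro borel_measurable_continuous_onI linear_continuous_on linear_conv_bounded_linear[THEN iffD1])
  fix l u :: "real ^ 'n::_"
  assume le: "\<And>b. b \<in> Basis \<Longrightarrow> l \<bullet> b \<le> u \<bullet> b"
  have B: "T -` box l u \<in> sets borel"
    using measurable_sets[of T borel borel "box l u"] by simp
  have im: "T -` box l u = inv T ` box l u"
    using bij by (simp add: bij_vimage_eq_inv_image)
  have ort: "orthogonal_transformation (inv T)"
    using T orthogonal_transformation_inv by blast
  have "inv T ` box l u \<in> lmeasurable"
    by (rule measurable_orthogonal_image[OF ort]) simp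
  then have "emeasure lebesgue (inv T ` box l u) = ennreal (measure lebesgue (inv T ` box l u))"
    using fmeasurableD2 emeasure_eq_ennreal_measure by blast
  also have "\<dots> = ennreal (measure lebesgue (box l u))"
    by (simp add: measure_orthogonal_image[OF ort])
  also have "\<dots> = (\<Prod>b\<in>Basis. (u - l) \<bullet> b)"
    using le by (simp add: measure_lborel_box_eq)
  finally show "emeasure (distr lborel borel T) (box l u) = (\<Prod>b\<in>Basis. (u - l) \<bullet> b)"
    using B im by (simp add: emeasure_distr)
qed simp

text \<open>Identifies the real plane with the complex numbers as measure spaces, so that invariance
  under orthogonal maps can be carried over to multiplication by unit numbers.\<close>

lemma distr_lborel_Complex: "distr lborel borel (\<lambda>x::real^2. Complex (x $ 1) (x $ 2)) = lborel"
proof (rule sym, rule lborel_eqI)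
  have [measurable]: "(\<lambda>x::real^2. Complex (x $ 1) (x $ 2)) \<in> borel_measurable borel"
    by (intro borel_measurable_continuous_onI) (simp add: Complex_eq continuous_intros)
  fix l u :: complex
  assume le: "\<And>b. b \<in> Basis \<Longrightarrow> l \<bullet> b \<le> u \<bullet> b"
  have vi: "(\<lambda>x::real^2. Complex (x $ 1) (x $ 2)) -` box l u
      = box (vector [Re l, Im l]) (vector [Re u, Im u])"
    by (auto simp: box_def Basis_complex_def Basis_vec_def forall_2 inner_axis vector_2)
  have [simp]: "axis 1 (1::real) \<noteq> (axis 2 1 :: real^2)"
    by (simp add: axis_eq_axis)
  have Ba: "(Basis :: (real^2) set) = {axis 1 1, axis 2 1}"
    by (auto simp: Basis_vec_def UNIV_2)
  have "Re l \<le> Re u" "Im l \<le> Im u"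
    using le[of 1] le[of \<i>] by (auto simp: Basis_complex_def)
  then have "emeasure lborel (box (vector [Re l, Im l] :: real^2) (vector [Re u, Im u])) 
     = ennreal ((Re u - Re l) * (Im u - Im l))"
    by (subst emeasure_lborel_box) (auto simp: Ba inner_axis vector_2 )
  also have "\<dots> = (\<Prod>b\<in>Basis. (u - l) \<bullet> b)"
    by (simp add: Basis_complex_def)
  finally show "emeasure (distr lborel borel (\<lambda>x::real^2. Complex (x $ 1) (x $ 2))) (box l u)
      = (\<Prod>b\<in>Basis. (u - l) \<bullet> b)"
    by (simp add: emeasure_distr vi)
qed simp

text \<open>The coordinate map \<open>\<phi>\<close> conjugates multiplication by u to a linear map
  T that preserves the norm and is therefore orthogonal.\<close>

lemma distr_lborel_rotation:
  assumes u: "cmod u = 1"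
  shows "distr lborel borel ((*) u) = lborel"
proof -
  define \<phi> where "\<phi> x = Complex (x $ 1) (x $ 2)" for x :: "real^2"
  define T :: "real^2 \<Rightarrow> real^2" where "T x = vector [Re (u * \<phi> x), Im (u * \<phi> x)]" for x
  have \<phi>T: "\<phi> (T x) = u * \<phi> x" for x
    by (simp add: \<phi>_def T_def vector_2 complex_eq_iff)
  have nrm: "norm x = cmod (\<phi> x)" for x
    by (simp add: \<phi>_def norm_vec_def L2_set_def sum_2 cmod_def)
  have "linear T"
    by (rule linearI) (auto simp: T_def \<phi>_def vec_eq_iff forall_2 vector_2 algebra_simps)
  then have T: "orthogonal_transformation T"
    unfolding orthogonal_transformation by (simp add: nrm \<phi>T norm_mult u)
  have [measurable]: "\<phi> \<in> borel_measurable borel"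
    unfolding \<phi>_def by (intro borel_measurable_continuous_onI) (simp add: Complex_eq continuous_intros)
  have [measurable]: "T \<in> borel_measurable borel"
    using \<open>linear T\<close> by (intro borel_measurable_continuous_onI linear_continuous_on linear_conv_bounded_linear[THEN iffD1])
  have \<phi>: "distr lborel borel \<phi> = lborel"
    using distr_lborel_Complex by (simp add: \<phi>_def[abs_def])
  have "distr lborel borel ((*) u) = distr (distr lborel borel \<phi>) borel ((*) u)"
    by (simp add: \<phi>)
  also have "\<dots> = distr (distr lborel borel T) borel \<phi>"
    by (simp add: distr_distr o_def \<phi>T)
  finally show ?thesis
    by (simp add: \<phi> distr_lborel_orthogonal_transformation[OF T])
qed

text \<open>Exchange the integrals over angle and plane: every rotated copy of F has the integral of
  F, and the angle runs over a probability space. This lets angular averages be taken without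
  changing variables to polar coordinates.\<close>

lemma integral_rotation_average:
  fixes F :: "complex \<Rightarrow> 'b::{banach, second_countable_topology}"
  assumes F: "integrable lborel F"
  defines "G \<equiv> \<lambda>z. LBINT t:{0..1}. F (z * cis (2 * pi * t))"
  shows "integral\<^sup>L lborel G = integral\<^sup>L lborel F"
proof -
  define I :: "real measure" where "I = restrict_space lborel {0..1}"
  have "emeasure I (space I) = 1"
    by (simp add: I_def emeasure_restrict_space)
  then interpret I: prob_space I
    by (rule prob_spaceI)
  interpret P: pair_sigma_finite I "lborel :: complex measure" ..
  have [measurable]: "F \<in> borel_measurable borel"
    using F by auto
  have [measurable]: "(\<lambda>t. t) \<in> measurable I borel"
    by (simp add: I_def measurable_restrict_space1)
  have [measurable]: "cis \<in> borel_measurable borel"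
    by (intro borel_measurable_continuous_onI continuous_intros)
  define H where "H = (\<lambda>(t, z). F (z * cis (2 * pi * t)))"
  have Hm[measurable]: "H \<in> borel_measurable (I \<Otimes>\<^sub>M lborel)"
    unfolding H_def by measurable
  have rot: "integrable lborel (\<lambda>z. H (t, z))"
    "(\<integral>z. H (t, z) \<partial>lborel) = integral\<^sup>L lborel F"
    "(\<integral>z. norm (H (t, z)) \<partial>lborel) = (\<integral>z. norm (F z) \<partial>lborel)" for t
  proof -
    define u where "u = cis (2 * pi * t)"
    have d: "distr lborel borel ((*) u) = lborel"
      by (rule distr_lborel_rotation) (simp add: u_def)
    show "integrable lborel (\<lambda>z. H (t, z))"
      using F integrable_distr_eq[of "(*) u" lborel borel F]
      by (simp add: d H_def u_def[symmetric] mult.commute[of _ u])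
    show "(\<integral>z. H (t, z) \<partial>lborel) = integral\<^sup>L lborel F"
      using integral_distr[of "(*) u" lborel borel F]
      by (simp add: d H_def u_def[symmetric] mult.commute[of _ u])
    show "(\<integral>z. norm (H (t, z)) \<partial>lborel) = (\<integral>z. norm (F z) \<partial>lborel)"
      using integral_distr[of "(*) u" lborel borel "\<lambda>z. norm (F z)"]
      by (simp add: d H_def u_def[symmetric] mult.commute[of _ u])
  qed
  \<comment> \<open>The integral of the norm over each slice does not depend on t, so it is
    integrable over the unit interval and Fubini applies.\<close>
  have "integrable (I \<Otimes>\<^sub>M lborel) H"
    by (rule P.Fubini_integrable) (auto simp: rot)
  then have H: "integrable (I \<Otimes>\<^sub>M lborel) (\<lambda>(t, z). H (t, z))"
    by simp
  have G: "G z = (\<integral>t. H (t, z) \<partial>I)" for z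
    unfolding G_def I_def H_def by (simp add: integral_restrict_space set_lebesgue_integral_def)
  show "integral\<^sup>L lborel G = integral\<^sup>L lborel F"
    using P.Fubini_integral[OF H] by (simp add: G[abs_def] rot I.prob_space)
qed

section \<open>The logarithmic weight and radial integrals\<close>

lemma log_weight_eq: "z \<noteq> 0 \<Longrightarrow> log_weight z = - 2 * ln (cmod z)"
  unfolding log_weight_def by (subst ln_div) (simp_all add: ln_realpow)

lemma log_weight_pos: "z \<in> punctured_disc \<Longrightarrow> 0 < log_weight z"
  using log_weight_eq[of z] by (simp add: punctured_disc_def)

lemma log_weight_nonneg: "z \<in> punctured_disc \<Longrightarrow> 0 \<le> log_weight z"
  using log_weight_pos by (rule less_imp_le)

lemma exp_minus_log_weight: "z \<noteq> 0 \<Longrightarrow> exp (- log_weight z) = (cmod z)\<^sup>2"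
  unfolding log_weight_def by (subst ln_div) simp_all

lemma borel_measurable_log_weight [measurable]: "log_weight \<in> borel_measurable borel"
  unfolding log_weight_def by measurable

lemma open_punctured_disc: "open punctured_disc"
proof -
  have "punctured_disc = ball 0 1 - {0}"
    by (auto simp: punctured_disc_def)
  then show ?thesis using open_Diff[of "ball (0::complex) 1" "{0}"] by simp
qed

lemma sets_punctured_disc [measurable]: "punctured_disc \<in> sets borel"
  using open_punctured_disc by (rule borel_open)

lemma emeasure_complex_ball: "0 \<le> r \<Longrightarrow> emeasure lborel (ball (c::complex) r) = ennreal (pi * r\<^sup>2)"
  by (simp add: emeasure_ball unit_ball_vol_2)

lemma emeasure_punctured_disc: "emeasure lborel punctured_disc = ennreal pi"
proof -
  have "punctured_disc = ball 0 1 - {0}"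
    by (auto simp: punctured_disc_def)
  moreover have "emeasure lborel (ball 0 1 - {0::complex}) = emeasure lborel (ball 0 1 :: complex set)"
    by (intro emeasure_Diff_null_set) auto
  ultimately show ?thesis
    using emeasure_complex_ball[of 1 0] by simp
qed

text \<open>The condition means |z| >= exp (-a/2), so the set is an annulus. Divided by pi, its area
  is the distribution function of the standard exponential law.\<close>

lemma emeasure_log_weight_atMost:
  assumes "0 \<le> a"
  shows "emeasure lborel (punctured_disc \<inter> {z. log_weight z \<le> a}) = ennreal (pi * (1 - exp (- a)))"
proof -
  have sub: "ball (0::complex) (exp (- a / 2)) \<subseteq> ball 0 1"
    using assms by (intro subset_ball) auto
  have "punctured_disc \<inter> {z. log_weight z \<le> a} = ball 0 1 - ball 0 (exp (- a / 2))"
  proof -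
    have "log_weight z \<le> a \<longleftrightarrow> exp (- a / 2) \<le> cmod z" if "z \<noteq> 0" for z
    proof -
      have "log_weight z \<le> a \<longleftrightarrow> - a / 2 \<le> ln (cmod z)"
        using that by (auto simp: log_weight_eq)
      also have "\<dots> \<longleftrightarrow> exp (- a / 2) \<le> cmod z"
        using that by (subst exp_le_cancel_iff[symmetric]) simp
      finally show ?thesis .
    qed
    then show ?thesis
      by (intro set_eqI, case_tac "x = 0") (auto simp: punctured_disc_def)
  qed
  moreover have "emeasure lborel (ball 0 1 - ball (0::complex) (exp (- a / 2)))
      = ennreal pi - ennreal (pi * exp (- a))"
    using sub emeasure_complex_ball[of 1 0] emeasure_complex_ball[of "exp (- a / 2)" 0]
    by (subst emeasure_Diff) (auto simp: power2_eq_square exp_add[symmetric])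
  ultimately show ?thesis
    by (simp add: ennreal_minus right_diff_distrib)
qed

text \<open>Under normalised area measure on the disc, \<open>log (1 / |z|\<^sup>2)\<close> is a standard exponential
  variable; this replaces integration in polar coordinates.\<close>

lemma nn_integral_radial:
  fixes \<phi> :: "real \<Rightarrow> ennreal"
  assumes [measurable]: "\<phi> \<in> borel_measurable borel"
  shows "(\<integral>\<^sup>+z. indicator punctured_disc z * \<phi> (log_weight z) \<partial>lborel)
    = pi * (\<integral>\<^sup>+t. exponential_density 1 t * \<phi> t \<partial>lborel)"
proof -
  define M where "M = uniform_measure lborel punctured_disc"
  have [simp]: "sets M = sets borel" "space M = UNIV"
    by (simp_all add: M_def)
  have nz: "emeasure lborel punctured_disc \<noteq> 0" "emeasure lborel punctured_disc \<noteq> \<infinity>"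
    by (simp_all add: emeasure_punctured_disc pi_neq_zero)
  interpret M: prob_space M
    unfolding M_def using nz by (rule prob_space_uniform_measure)
  have "distributed M lborel log_weight (exponential_density 1)"
  proof (rule erlang_distributedI)
    show "log_weight \<in> borel_measurable M"
      unfolding M_def by simp
    fix a :: real assume a: "0 \<le> a"
    have "emeasure M {z \<in> space M. log_weight z \<le> a}
        = emeasure lborel (punctured_disc \<inter> {z. log_weight z \<le> a}) / emeasure lborel punctured_disc"
      unfolding M_def by (subst emeasure_uniform_measure) auto
    also have "\<dots> = ennreal (1 - exp (- a))"
      using a by (simp add: emeasure_log_weight_atMost emeasure_punctured_disc divide_ennreal)
    finally show "emeasure M {z \<in> space M. log_weight z \<le> a} = ennreal (erlang_CDF 0 1 a)"
      using a by (simp add: erlang_CDF_def)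
  qed simp
  from distributed_nn_integral[OF this, of \<phi>]
  have "(\<integral>\<^sup>+t. exponential_density 1 t * \<phi> t \<partial>lborel) = (\<integral>\<^sup>+z. \<phi> (log_weight z) \<partial>M)"
    by simp
  also have "\<dots> = (\<integral>\<^sup>+z. \<phi> (log_weight z) * indicator punctured_disc z \<partial>lborel) / pi"
    unfolding M_def by (subst nn_integral_uniform_measure) (auto simp: emeasure_punctured_disc)
  finally have "pi * (\<integral>\<^sup>+t. exponential_density 1 t * \<phi> t \<partial>lborel)
      = pi * ((\<integral>\<^sup>+z. \<phi> (log_weight z) * indicator punctured_disc z \<partial>lborel) / pi)"
    by simp
  also have "\<dots> = (\<integral>\<^sup>+z. \<phi> (log_weight z) * indicator punctured_disc z \<partial>lborel)"
    by (subst ennreal_times_divide, subst mult.commute, rule ennreal_mult_divide_eq) (auto simp: pi_neq_zero)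
  finally show ?thesis
    by (simp add: mult.commute)
qed

text \<open>The density, with respect to area, of \<open>log (1 / |z|\<^sup>2) ^ (m + 2)\<close> times the Poincare measure.\<close>

definition weight :: "nat \<Rightarrow> complex \<Rightarrow> real" where
  "weight m z = indicator punctured_disc z * (2 * log_weight z ^ m / (cmod z)\<^sup>2)"

lemma weight_nonneg [simp]: "0 \<le> weight m z"
  by (cases "z \<in> punctured_disc") (auto simp: weight_def log_weight_nonneg)

lemma borel_measurable_weight [measurable]: "weight m \<in> borel_measurable borel"
  unfolding weight_def by measurable

lemma weight_outside: "z \<notin> punctured_disc \<Longrightarrow> weight m z = 0"
  by (simp add: weight_def)

lemma weight_rotate: "cmod u = 1 \<Longrightarrow> weight m (z * u) = weight m z"
  by (cases "u = 0") (simp_all add: weight_def punctured_disc_def log_weight_def norm_mult indicator_def)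

text \<open>The squared norm of \<open>z ^ a\<close> in the space with exponent m + 2; the shift by
  2 comes from the squared logarithm in the denominator of the Poincare form.\<close>

definition monomial_norm2 :: "nat \<Rightarrow> nat \<Rightarrow> real" where
  "monomial_norm2 m a = 2 * pi * fact m / real a ^ Suc m"

lemma monomial_norm2_pos: "0 < a \<Longrightarrow> 0 < monomial_norm2 m a"
  by (simp add: monomial_norm2_def)

text \<open>In the variable t = log (1 / |z|^2), the factor |z|^(2a - 2) is exp (-(a - 1) t), and
  the exponential law supplies another exp (-t). What remains is a Gamma integral of t^m exp (-a
  t).\<close>

lemma nn_integral_weight_monomial:
  assumes "0 < a"
  shows "(\<integral>\<^sup>+z. ennreal (weight m z * cmod (z ^ a) ^ 2) \<partial>lborel) = ennreal (monomial_norm2 m a)"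
proof -
  define \<phi> where "\<phi> t = ennreal (2 * t ^ m * exp (- (real a - 1) * t))" for t
  have [measurable]: "\<phi> \<in> borel_measurable borel"
    unfolding \<phi>_def by measurable
  have "(\<integral>\<^sup>+z. ennreal (weight m z * cmod (z ^ a) ^ 2) \<partial>lborel)
      = (\<integral>\<^sup>+z. indicator punctured_disc z * \<phi> (log_weight z) \<partial>lborel)"
  proof (rule nn_integral_cong)
    fix z :: complex
    show "ennreal (weight m z * cmod (z ^ a) ^ 2) = indicator punctured_disc z * \<phi> (log_weight z)"
    proof (cases "z \<in> punctured_disc")
      case True
      then have z: "z \<noteq> 0" by (auto simp: punctured_disc_def)
      obtain b where b: "a = Suc b" using assms gr0_implies_Suc by blast
      have "exp (- (real a - 1) * log_weight z) = exp (- log_weight z) ^ b"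
        by (simp add: b exp_of_nat_mult[symmetric])
      also have "\<dots> = ((cmod z)\<^sup>2) ^ b"
        using z by (simp add: exp_minus_log_weight)
      finally show ?thesis
        using True z by (simp add: weight_def \<phi>_def b norm_mult norm_power power_mult_distrib
            power_mult[symmetric] mult_ac)
    qed (simp add: weight_def)
  qed
  also have "\<dots> = pi * (\<integral>\<^sup>+t. exponential_density 1 t * \<phi> t \<partial>lborel)"
    by (rule nn_integral_radial) simp
  also have "(\<integral>\<^sup>+t. exponential_density 1 t * \<phi> t \<partial>lborel)
      = (\<integral>\<^sup>+t. ennreal (2 * fact m / real a ^ Suc m) * ennreal (erlang_density m (real a) t) \<partial>lborel)"
  proof (rule nn_integral_cong)
    fix t :: real
    show "exponential_density 1 t * \<phi> t
        = ennreal (2 * fact m / real a ^ Suc m) * ennreal (erlang_density m (real a) t)"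
    proof (cases "t < 0")
      case False
      have "exp (- t) * exp (- (real a - 1) * t) = exp (- (real a * t))"
        unfolding mult_exp_exp by (simp add: algebra_simps)
      then have "exp (- t) * (2 * t ^ m * exp (- (real a - 1) * t)) = 2 * t ^ m * exp (- (real a * t))"
        by (simp only: mult.left_commute[of "exp (- t)"])
      moreover have "2 * fact m / real a ^ Suc m * (real a ^ Suc m * t ^ m * exp (- (real a * t)) / fact m)
          = 2 * t ^ m * exp (- (real a * t))"
        using assms by (simp del: power_Suc)
      ultimately show ?thesis
        using False by (simp add: \<phi>_def erlang_density_def ennreal_mult'[symmetric] del: power_Suc)
    qed (simp add: erlang_density_def)
  qed
  \<comment> \<open>The zeroth moment is used: the Erlang density has total mass 1.\<close>
  also have "\<dots> = ennreal (2 * fact m / real a ^ Suc m)"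
    using assms nn_integral_erlang_ith_moment[of "real a" m 0]
    by (subst nn_integral_cmult) auto
  finally show ?thesis
    by (simp add: monomial_norm2_def ennreal_mult'[symmetric] mult_ac)
qed

section \<open>Taylor coefficients as circle averages\<close>

text \<open>Cauchy's formula for the n-th derivative with u = cis (2 pi t): du / u^(n + 1) equals 2
  pi i u^(-n) dt, and on the unit circle the inverse of u is its conjugate.\<close>

lemma circle_average_unit:
  assumes "continuous_on (cball 0 1) f" "f holomorphic_on ball 0 1"
  shows "(LBINT t:{0..1}. f (cis (2 * pi * t)) * cnj (cis (2 * pi * t)) ^ n) = (deriv ^^ n) f 0 / fact n"
proof -
  let ?g = "\<lambda>t::real. f (cis (2 * pi * t)) * cnj (cis (2 * pi * t)) ^ n"
  have "((\<lambda>u. f u / (u - 0) ^ Suc n) has_contour_integral (2 * pi * \<i> / fact n * (deriv ^^ n) f 0))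
      (circlepath 0 1)"
    by (rule Cauchy_has_contour_integral_higher_derivative_circlepath) (use assms in auto)
  then have 1: "((\<lambda>t. f (circlepath 0 1 t) / circlepath 0 1 t ^ Suc n *
       vector_derivative (circlepath 0 1) (at t)) has_integral (2 * pi * \<i> / fact n * (deriv ^^ n) f 0)) {0..1}"
    by (simp add: has_contour_integral)
  have "((\<lambda>t. 2 * pi * \<i> * ?g t) has_integral (2 * pi * \<i> / fact n * (deriv ^^ n) f 0)) {0..1}"
  proof (rule has_integral_eq[OF _ 1])
    fix t :: real assume t: "t \<in> {0..1}"
    have c: "circlepath 0 1 t = cis (2 * pi * t)"
      by (simp add: circlepath cis_conv_exp mult_ac)
    have "inverse (cis (2 * pi * t)) = cnj (cis (2 * pi * t))"
      by (simp add: cis_cnj)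
    then have i: "1 / cis (2 * pi * t) ^ n = cnj (cis (2 * pi * t)) ^ n"
      by (simp add: divide_inverse power_inverse[symmetric] del: cis_inverse)
    have v: "vector_derivative (circlepath 0 1) (at t) = 2 * pi * \<i> * cis (2 * pi * t)"
      by (simp add: vector_derivative_circlepath cis_conv_exp mult_ac)
    have "f (cis (2 * pi * t)) / cis (2 * pi * t) ^ Suc n * (2 * pi * \<i> * cis (2 * pi * t))
        = 2 * pi * \<i> * (f (cis (2 * pi * t)) * (1 / cis (2 * pi * t) ^ n))"
      by (simp add: field_simps)
    then show "f (circlepath 0 1 t) / circlepath 0 1 t ^ Suc n * vector_derivative (circlepath 0 1) (at t)
        = 2 * pi * \<i> * ?g t"
      unfolding c v i .
  qed
  from has_integral_mult_right[OF this, of "1 / (2 * pi * \<i>)"]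
  have g: "(?g has_integral (deriv ^^ n) f 0 / fact n) {0..1}"
    by (simp add: field_simps)
  have "continuous_on {0..1} ?g"
    by (intro continuous_intros continuous_on_compose2[OF assms(1)]) auto
  then have "set_integrable lborel {0..1} ?g"
    by (rule borel_integrable_atLeastAtMost')
  then have "(LBINT t:{0..1}. ?g t) = integral {0..1} ?g"
    by (rule set_borel_integral_eq_integral)
  then show ?thesis
    using g by (simp add: integral_unique)
qed

text \<open>Rescaling reduces to the unit circle: u -> f (z u) is holomorphic on a ball of radius R
  / |z| > 1, and the chain rule produces \<open>z ^ n\<close>. For z = 0 the rescaled function is
  constant.\<close>

lemma circle_average:
  assumes f: "f holomorphic_on ball 0 R" and z: "cmod z < R"
  shows "(LBINT t:{0..1}. f (z * cis (2 * pi * t)) * cnj (cis (2 * pi * t)) ^ n)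
    = (deriv ^^ n) f 0 / fact n * z ^ n"
proof (cases "z = 0")
  case True
  then show ?thesis
    using circle_average_unit[of "\<lambda>_. f 0" n] by simp
next
  case False
  define S where "S = ball (0::complex) (R / cmod z)"
  have R: "0 < R / cmod z" "1 < R / cmod z"
    using z False by (auto simp: field_simps intro: le_less_trans[OF norm_ge_zero])
  have im: "z * w \<in> ball 0 R" if "w \<in> S" for w
    using that False by (simp add: S_def norm_mult field_simps)
  have hol: "(\<lambda>u. f (z * u)) holomorphic_on S"
    using holomorphic_on_compose_gen[OF _ f, of "\<lambda>u. z * u" S] im
    by (auto simp: o_def image_subset_iff intro!: holomorphic_intros)
  have sub: "cball 0 1 \<subseteq> S" "ball 0 1 \<subseteq> S"
    using R by (auto simp: S_def)
  have "(LBINT t:{0..1}. f (z * cis (2 * pi * t)) * cnj (cis (2 * pi * t)) ^ n)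
      = (deriv ^^ n) (\<lambda>u. f (z * u)) 0 / fact n"
    using sub hol
    by (intro circle_average_unit holomorphic_on_imp_continuous_on) (auto intro: holomorphic_on_subset)
  also have "(deriv ^^ n) (\<lambda>u. f (z * u)) 0 = z ^ n * (deriv ^^ n) f (z * 0)"
    by (rule higher_deriv_compose_linear[OF f, of S]) (use R im in \<open>auto simp: S_def\<close>)
  finally show ?thesis
    by simp
qed

section \<open>The weighted Bergman space\<close>

text \<open>Keeps the exponent \<open>m + 2\<close> from being rewritten to \<open>Suc (Suc m)\<close>.\<close>

declare add_2_eq_Suc [simp del] add_2_eq_Suc' [simp del]

text \<open>Values of \<open>\<phi>\<close> off the punctured disc are arbitrary, but the weight
  vanishes there, so an indicator can be inserted to obtain measurability.\<close>

lemma borel_measurable_weight_scaleR: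
  fixes \<phi> :: "complex \<Rightarrow> 'b::{real_normed_vector, second_countable_topology}"
  assumes "continuous_on punctured_disc \<phi>"
  shows "(\<lambda>z. weight m z *\<^sub>R \<phi> z) \<in> borel_measurable borel"
proof -
  have [measurable]: "(\<lambda>z. indicator punctured_disc z *\<^sub>R \<phi> z) \<in> borel_measurable borel"
    using assms by (intro borel_measurable_continuous_on_indicator) auto
  have "(\<lambda>z. weight m z *\<^sub>R (indicator punctured_disc z *\<^sub>R \<phi> z)) \<in> borel_measurable borel"
    by measurable
  also have "(\<lambda>z. weight m z *\<^sub>R (indicator punctured_disc z *\<^sub>R \<phi> z)) = (\<lambda>z. weight m z *\<^sub>R \<phi> z)"
    by (auto simp: weight_def indicator_def)
  finally show ?thesis .
qed

text \<open>Turns Poincare integrals into area integrals: two powers of the logarithm cancel against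
  the density and \<open>weight m\<close> is left. Continuity on the disc yields measurability of
  the integrand cut off to the disc.\<close>

lemma poincare_weight:
  fixes \<phi> :: "complex \<Rightarrow> 'b::{banach, second_countable_topology}"
  assumes "continuous_on punctured_disc \<phi>"
  shows set_integrable_poincare_weight:
      "set_integrable poincare_measure punctured_disc (\<lambda>z. log_weight z ^ (m + 2) *\<^sub>R \<phi> z)
        \<longleftrightarrow> integrable lborel (\<lambda>z. weight m z *\<^sub>R \<phi> z)" (is ?A)
    and set_integral_poincare_weight:
      "(LINT z:punctured_disc|poincare_measure. log_weight z ^ (m + 2) *\<^sub>R \<phi> z)
        = (LINT z|lborel. weight m z *\<^sub>R \<phi> z)" (is ?B)
proof -
  let ?d = "\<lambda>z. indicator punctured_disc z * (2 / ((cmod z)\<^sup>2 * (log_weight z)\<^sup>2))"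
  let ?\<psi> = "\<lambda>z. indicator punctured_disc z *\<^sub>R (log_weight z ^ (m + 2) *\<^sub>R \<phi> z)"
  have [measurable]: "(\<lambda>z. indicator punctured_disc z *\<^sub>R \<phi> z) \<in> borel_measurable borel"
    using assms by (intro borel_measurable_continuous_on_indicator) auto
  have "(\<lambda>z. log_weight z ^ (m + 2) *\<^sub>R (indicator punctured_disc z *\<^sub>R \<phi> z)) \<in> borel_measurable borel"
    by measurable
  then have \<psi>: "?\<psi> \<in> borel_measurable lborel"
    by (simp add: mult_ac)
  have d1: "?d \<in> borel_measurable lborel"
    by measurable
  have d2: "AE z in lborel. 0 \<le> ?d z"
    by (rule AE_I2) simp
  note d = d1 d2
  have eq: "?d z *\<^sub>R ?\<psi> z = weight m z *\<^sub>R \<phi> z" for z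
  proof (cases "z \<in> punctured_disc")
    case True
    then show ?thesis
      using log_weight_pos[OF True] by (simp add: weight_def power_add power2_eq_square)
  qed (simp add: weight_def)
  show ?A
    unfolding set_integrable_def poincare_measure_def by (simp only: integrable_density[OF \<psi> d] eq)
  show ?B
    unfolding set_lebesgue_integral_def poincare_measure_def
    by (simp only: integral_density[OF \<psi> d] eq)
qed

lemma bergman_space_iff:
  "f \<in> bergman_space (m + 2) \<longleftrightarrow>
    f holomorphic_on punctured_disc \<and> integrable lborel (\<lambda>z. weight m z * (cmod (f z))\<^sup>2)"
proof -
  have "continuous_on punctured_disc (\<lambda>z. (cmod (f z))\<^sup>2)" if "f holomorphic_on punctured_disc"
    using that by (intro continuous_intros holomorphic_on_imp_continuous_on)
  from set_integrable_poincare_weight[OF this, of m] show ?thesis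
    by (auto simp: bergman_space_def mult.commute)
qed

lemma bergman_space_holomorphic: "f \<in> bergman_space k \<Longrightarrow> f holomorphic_on punctured_disc"
  by (simp add: bergman_space_def)

lemma bergman_space_continuous: "f \<in> bergman_space k \<Longrightarrow> continuous_on punctured_disc f"
  using bergman_space_holomorphic holomorphic_on_imp_continuous_on by blast

lemma bergman_space_integrable:
  "f \<in> bergman_space (m + 2) \<Longrightarrow> integrable lborel (\<lambda>z. weight m z * (cmod (f z))\<^sup>2)"
  by (simp only: bergman_space_iff)

lemma bergman_inner_eq:
  assumes "f \<in> bergman_space (m + 2)" "g \<in> bergman_space (m + 2)"
  shows "bergman_inner (m + 2) f g = (LINT z|lborel. weight m z *\<^sub>R (f z * cnj (g z)))"
proof -
  have "continuous_on punctured_disc (\<lambda>z. f z * cnj (g z))"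
    using assms by (intro continuous_intros bergman_space_continuous)
  from set_integral_poincare_weight[OF this, of m] show ?thesis
    by (simp add: bergman_inner_def scaleR_conv_of_real mult_ac)
qed

lemma bergman_norm2_eq:
  assumes "f \<in> bergman_space (m + 2)"
  shows "(bergman_norm (m + 2) f)\<^sup>2 = (LINT z|lborel. weight m z * (cmod (f z))\<^sup>2)"
proof -
  have "continuous_on punctured_disc (\<lambda>z. (cmod (f z))\<^sup>2)"
    using assms by (intro continuous_intros bergman_space_continuous)
  from set_integral_poincare_weight[OF this, of m]
  have "bergman_norm (m + 2) f = sqrt (LINT z|lborel. weight m z * (cmod (f z))\<^sup>2)"
    by (simp add: bergman_norm_def mult.commute)
  then show ?thesis
    by (simp add: integral_nonneg_AE)
qed

lemma bergman_norm_nonneg: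
  assumes "f \<in> bergman_space (m + 2)"
  shows "0 \<le> bergman_norm (m + 2) f"
proof -
  have "continuous_on punctured_disc (\<lambda>z. (cmod (f z))\<^sup>2)"
    using assms by (intro continuous_intros bergman_space_continuous)
  from set_integral_poincare_weight[OF this, of m] show ?thesis
    by (simp add: bergman_norm_def mult.commute integral_nonneg_AE)
qed

text \<open>Dominated by the two squared moduli, since |f g| <= |f|^2 + |g|^2.\<close>

lemma integrable_weight_mult_cnj:
  assumes f: "f \<in> bergman_space (m + 2)" and g: "g \<in> bergman_space (m + 2)"
  shows "integrable lborel (\<lambda>z. weight m z *\<^sub>R (f z * cnj (g z)))"
proof (rule Bochner_Integration.integrable_bound)
  show "integrable lborel (\<lambda>z. weight m z * (cmod (f z))\<^sup>2 + weight m z * (cmod (g z))\<^sup>2)"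
    using bergman_space_integrable[OF f] bergman_space_integrable[OF g] by simp
  have "continuous_on punctured_disc (\<lambda>z. f z * cnj (g z))"
    using f g by (intro continuous_intros bergman_space_continuous)
  then show "(\<lambda>z. weight m z *\<^sub>R (f z * cnj (g z))) \<in> borel_measurable lborel"
    using borel_measurable_weight_scaleR by simp
  have "cmod (f z) * cmod (g z) \<le> (cmod (f z))\<^sup>2 + (cmod (g z))\<^sup>2" for z
    using sum_squares_bound[of "cmod (f z)" "cmod (g z)"] 
      mult_nonneg_nonneg[OF norm_ge_zero[of "f z"] norm_ge_zero[of "g z"]]
    by linarith
  then have "weight m z * (cmod (f z) * cmod (g z)) \<le> weight m z * ((cmod (f z))\<^sup>2 + (cmod (g z))\<^sup>2)" for z
    by (rule mult_left_mono) simp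
  then show "AE z in lborel. norm (weight m z *\<^sub>R (f z * cnj (g z)))
      \<le> norm (weight m z * (cmod (f z))\<^sup>2 + weight m z * (cmod (g z))\<^sup>2)"
    by (simp add: norm_mult distrib_left)
qed

lemma bergman_space_scale:
  assumes "f \<in> bergman_space (m + 2)"
  shows "(\<lambda>z. c * f z) \<in> bergman_space (m + 2)"
proof -
  have "integrable lborel (\<lambda>z. (cmod c)\<^sup>2 * (weight m z * (cmod (f z))\<^sup>2))"
    using bergman_space_integrable[OF assms] by simp
  then show ?thesis
    using bergman_space_holomorphic[OF assms] unfolding bergman_space_iff
    by (auto simp: norm_mult power_mult_distrib mult_ac intro!: holomorphic_intros)
qed

lemma bergman_space_add:
  assumes f: "f \<in> bergman_space (m + 2)" and g: "g \<in> bergman_space (m + 2)"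
  shows "(\<lambda>z. f z + g z) \<in> bergman_space (m + 2)"
  unfolding bergman_space_iff
proof
  show "(\<lambda>z. f z + g z) holomorphic_on punctured_disc"
    using f g by (intro holomorphic_intros bergman_space_holomorphic)
  have "integrable lborel (\<lambda>z. weight m z * (cmod (f z))\<^sup>2 + weight m z * (cmod (g z))\<^sup>2
      + 2 * Re (weight m z *\<^sub>R (f z * cnj (g z))))"
    using bergman_space_integrable[OF f] bergman_space_integrable[OF g] integrable_weight_mult_cnj[OF f g]
    by (intro Bochner_Integration.integrable_add integrable_mult_right integrable_Re)
  moreover have "(cmod (a + b))\<^sup>2 = (cmod a)\<^sup>2 + (cmod b)\<^sup>2 + 2 * Re (a * cnj b)" for a b
    by (simp add: cmod_power2) (simp add: power2_eq_square algebra_simps)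
  ultimately show "integrable lborel (\<lambda>z. weight m z * (cmod (f z + g z))\<^sup>2)"
    by (simp add: distrib_left mult.left_commute)
qed

lemma bergman_space_zero: "(\<lambda>z. 0) \<in> bergman_space (m + 2)"
  unfolding bergman_space_iff by simp

lemma bergman_space_diff:
  assumes "f \<in> bergman_space (m + 2)" "g \<in> bergman_space (m + 2)"
  shows "(\<lambda>z. f z - g z) \<in> bergman_space (m + 2)"
  using bergman_space_add[OF assms(1) bergman_space_scale[OF assms(2), of "-1"]] by simp

lemma bergman_space_sum:
  assumes "\<And>i. i \<in> I \<Longrightarrow> f i \<in> bergman_space (m + 2)"
  shows "(\<lambda>z. \<Sum>i\<in>I. c i * f i z) \<in> bergman_space (m + 2)"
  using assms
proof (induction I rule: infinite_finite_induct)
  case (insert i I)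
  then show ?case
    using bergman_space_add[OF bergman_space_scale[of "f i" m "c i"], of "\<lambda>z. \<Sum>i\<in>I. c i * f i z"]
    by simp
qed (use bergman_space_zero in auto)

lemma bergman_inner_cnj:
  assumes "f \<in> bergman_space (m + 2)" "g \<in> bergman_space (m + 2)"
  shows "bergman_inner (m + 2) g f = cnj (bergman_inner (m + 2) f g)"
  unfolding bergman_inner_eq[OF assms] bergman_inner_eq[OF assms(2,1)] Bochner_Integration.integral_cnj[symmetric]
  by (simp add: mult.commute)

lemma bergman_inner_self:
  assumes "f \<in> bergman_space (m + 2)"
  shows "bergman_inner (m + 2) f f = of_real ((bergman_norm (m + 2) f)\<^sup>2)"
proof -
  have "bergman_inner (m + 2) f f = (LINT z|lborel. of_real (weight m z * (cmod (f z))\<^sup>2))"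
    unfolding bergman_inner_eq[OF assms assms]
    by (simp add: scaleR_conv_of_real complex_norm_square[symmetric])
  then show ?thesis
    by (simp only: bergman_norm2_eq[OF assms] integral_complex_of_real)
qed

lemma bergman_inner_sum_left:
  assumes f: "\<And>i. i \<in> I \<Longrightarrow> f i \<in> bergman_space (m + 2)" and g: "g \<in> bergman_space (m + 2)"
  shows "bergman_inner (m + 2) (\<lambda>z. \<Sum>i\<in>I. c i * f i z) g = (\<Sum>i\<in>I. c i * bergman_inner (m + 2) (f i) g)"
proof -
  have s: "(\<lambda>z. \<Sum>i\<in>I. c i * f i z) \<in> bergman_space (m + 2)"
    by (rule bergman_space_sum) (rule f)
  have "bergman_inner (m + 2) (\<lambda>z. \<Sum>i\<in>I. c i * f i z) g
      = (LINT z|lborel. (\<Sum>i\<in>I. c i * (weight m z *\<^sub>R (f i z * cnj (g z)))))"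
    unfolding bergman_inner_eq[OF s g]
    by (simp add: sum_distrib_right scaleR_sum_right mult.assoc mult_scaleR_right)
  also have "\<dots> = (\<Sum>i\<in>I. LINT z|lborel. c i * (weight m z *\<^sub>R (f i z * cnj (g z))))"
    by (intro Bochner_Integration.integral_sum integrable_mult_right integrable_weight_mult_cnj f g)
  also have "\<dots> = (\<Sum>i\<in>I. c i * bergman_inner (m + 2) (f i) g)"
    by (intro sum.cong refl) (simp add: bergman_inner_eq f g del: mult_scaleR_right)
  finally show ?thesis .
qed

lemma bergman_inner_diff_left:
  assumes "f \<in> bergman_space (m + 2)" "g \<in> bergman_space (m + 2)" "h \<in> bergman_space (m + 2)"
  shows "bergman_inner (m + 2) (\<lambda>z. f z - g z) h = bergman_inner (m + 2) f h - bergman_inner (m + 2) g h"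
  unfolding bergman_inner_eq[OF bergman_space_diff[OF assms(1,2)] assms(3)]
    bergman_inner_eq[OF assms(1,3)] bergman_inner_eq[OF assms(2,3)]
  by (subst Bochner_Integration.integral_diff[symmetric])
     (simp_all only: integrable_weight_mult_cnj assms left_diff_distrib scaleR_diff_right)

text \<open>Isolates the first two conditions of \<open>bergman_onb\<close>, the form in which
  Pythagoras and Bessel use a family.\<close>

definition bergman_orthonormal :: "nat \<Rightarrow> (nat \<Rightarrow> complex \<Rightarrow> complex) \<Rightarrow> bool" where
  "bergman_orthonormal k f \<longleftrightarrow> (\<forall>i. f i \<in> bergman_space k) \<and>
     (\<forall>i j. bergman_inner k (f i) (f j) = (if i = j then 1 else 0))"

lemma bergman_norm2_orthonormal_sum:
  assumes f: "bergman_orthonormal (m + 2) f" and I: "finite I"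
  shows "(bergman_norm (m + 2) (\<lambda>z. \<Sum>i\<in>I. c i * f i z))\<^sup>2 = (\<Sum>i\<in>I. (cmod (c i))\<^sup>2)"
proof -
  let ?s = "\<lambda>z. \<Sum>i\<in>I. c i * f i z"
  have fs: "f i \<in> bergman_space (m + 2)" for i
    using f by (simp add: bergman_orthonormal_def)
  have s: "?s \<in> bergman_space (m + 2)"
    by (rule bergman_space_sum) (rule fs)
  have si: "bergman_inner (m + 2) ?s (f i) = c i" if "i \<in> I" for i
  proof -
    have orth: "bergman_inner (m + 2) (f j) (f i) = (if j = i then 1 else 0)" for j
      using f unfolding bergman_orthonormal_def by blast
    show ?thesis
      using that I by (simp add: bergman_inner_sum_left fs orth if_distrib cong: if_cong)
  qed
  have "complex_of_real ((bergman_norm (m + 2) ?s)\<^sup>2) = (\<Sum>i\<in>I. c i * bergman_inner (m + 2) (f i) ?s)"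
    using bergman_inner_self[OF s] bergman_inner_sum_left[of I f, OF fs s] by simp
  also have "\<dots> = (\<Sum>i\<in>I. c i * cnj (c i))"
    by (intro sum.cong refl) (simp only: bergman_inner_cnj[OF s fs] si)
  also have "\<dots> = complex_of_real (\<Sum>i\<in>I. (cmod (c i))\<^sup>2)"
    by (simp add: complex_norm_square[symmetric])
  finally show ?thesis
    by (simp only: of_real_eq_iff)
qed

text \<open>Let s be the finite Fourier sum of g. The inner products of s with g, of g with s and of
  s with itself all equal the sum S of the squared coefficients, so the squared norm of g - s is
  that of g minus S, and it is nonnegative.\<close>

lemma bergman_bessel:
  assumes f: "bergman_orthonormal (m + 2) f" and g: "g \<in> bergman_space (m + 2)" and I: "finite I"
  shows "(\<Sum>i\<in>I. (cmod (bergman_inner (m + 2) g (f i)))\<^sup>2) \<le> (bergman_norm (m + 2) g)\<^sup>2"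
proof -
  define c where "c i = bergman_inner (m + 2) g (f i)" for i
  let ?s = "\<lambda>z. \<Sum>i\<in>I. c i * f i z"
  have fs: "f i \<in> bergman_space (m + 2)" for i
    using f by (simp add: bergman_orthonormal_def)
  have s: "?s \<in> bergman_space (m + 2)"
    by (rule bergman_space_sum) (rule fs)
  have d: "(\<lambda>z. g z - ?s z) \<in> bergman_space (m + 2)"
    by (rule bergman_space_diff[OF g s])
  define S where "S = (\<Sum>i\<in>I. (cmod (c i))\<^sup>2)"
  have sg: "bergman_inner (m + 2) ?s g = of_real S"
  proof -
    have "bergman_inner (m + 2) ?s g = (\<Sum>i\<in>I. c i * bergman_inner (m + 2) (f i) g)"
      by (rule bergman_inner_sum_left) (use fs g in auto)
    also have "\<dots> = (\<Sum>i\<in>I. c i * cnj (c i))"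
      by (intro sum.cong refl) (simp only: bergman_inner_cnj[OF g fs] c_def)
    finally show ?thesis
      by (simp add: S_def complex_norm_square[symmetric])
  qed
  then have gs: "bergman_inner (m + 2) g ?s = of_real S"
    using bergman_inner_cnj[OF s g] by simp
  have ss: "bergman_inner (m + 2) ?s ?s = of_real S"
    using bergman_inner_self[OF s] bergman_norm2_orthonormal_sum[OF f I, of c] by (simp add: S_def)
  have "complex_of_real ((bergman_norm (m + 2) (\<lambda>z. g z - ?s z))\<^sup>2)
      = bergman_inner (m + 2) g (\<lambda>z. g z - ?s z) - bergman_inner (m + 2) ?s (\<lambda>z. g z - ?s z)"
    using bergman_inner_self[OF d] bergman_inner_diff_left[OF g s d] by simp
  \<comment> \<open>Linearity is at hand in the left argument, so a difference on the right is moved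
    there by conjugation.\<close>
  also have "bergman_inner (m + 2) g (\<lambda>z. g z - ?s z) = cnj (of_real ((bergman_norm (m + 2) g)\<^sup>2) - of_real S)"
    by (simp only: bergman_inner_cnj[OF d g] bergman_inner_diff_left[OF g s g] bergman_inner_self[OF g] sg)
  also have "bergman_inner (m + 2) ?s (\<lambda>z. g z - ?s z) = cnj (of_real S - of_real S)"
    by (simp only: bergman_inner_cnj[OF d s] bergman_inner_diff_left[OF g s s] gs ss)
  finally have "complex_of_real ((bergman_norm (m + 2) (\<lambda>z. g z - ?s z))\<^sup>2)
      = of_real ((bergman_norm (m + 2) g)\<^sup>2 - S)"
    by simp
  then have "(bergman_norm (m + 2) (\<lambda>z. g z - ?s z))\<^sup>2 = (bergman_norm (m + 2) g)\<^sup>2 - S"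
    by (simp only: of_real_eq_iff)
  then show ?thesis
    using zero_le_power2[of "bergman_norm (m + 2) (\<lambda>z. g z - ?s z)"] by (simp add: S_def c_def)
qed

section \<open>Evaluation at a point and extension across the puncture\<close>

text \<open>The square of f is holomorphic, so its value at z is its mean over the disc of radius r
  about z, which avoids the puncture and stays inside the unit disc. There the weight is at least
  its value c at modulus \<rho>, because both of its factors decrease with the modulus; hence the
  area integral of |f|^2 is at most the squared norm over c.\<close>

lemma bergman_mean_value_bound:
  assumes f: "f \<in> bergman_space (m + 2)" and r: "0 < r" "r < cmod z" "cmod z + r < 1"
  defines "\<rho> \<equiv> cmod z + r"
  shows "(cmod (f z))\<^sup>2 \<le> \<rho>\<^sup>2 / (2 * pi * r\<^sup>2 * ln (1 / \<rho>\<^sup>2) ^ m) * (bergman_norm (m + 2) f)\<^sup>2"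
proof -
  define c where "c = 2 * ln (1 / \<rho>\<^sup>2) ^ m / \<rho>\<^sup>2"
  have \<rho>: "0 < \<rho>" "\<rho> < 1" using r by (auto simp: \<rho>_def)
  then have l: "0 < ln (1 / \<rho>\<^sup>2)"
    by (intro ln_gt_zero) (simp add: power_less_one_iff field_simps)
  have c: "0 < c" using \<rho> l by (simp add: c_def)
  have inD: "z + w \<in> punctured_disc" "cmod (z + w) \<le> \<rho>" if "w \<in> ball 0 r" for w
  proof -
    have "cmod (z + w) \<le> \<rho>" "cmod z - cmod w \<le> cmod (z + w)"
      using that norm_triangle_ineq[of z w] norm_diff_ineq[of z w] by (auto simp: \<rho>_def)
    then show "z + w \<in> punctured_disc" "cmod (z + w) \<le> \<rho>"
      using that r \<rho> by (auto simp: punctured_disc_def simp del: zero_less_norm_iff)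
  qed
  have weight_ge: "c \<le> weight m (z + w)" if "w \<in> ball 0 r" for w
  proof -
    have pos: "0 < cmod (z + w)" using inD[OF that] by (simp add: punctured_disc_def)
    then have "1 / \<rho>\<^sup>2 \<le> 1 / (cmod (z + w))\<^sup>2"
      using inD[OF that] \<rho> by (intro divide_left_mono power_mono) auto
    then have "ln (1 / \<rho>\<^sup>2) \<le> log_weight (z + w)"
      using \<rho> pos unfolding log_weight_def by (subst ln_le_cancel_iff) auto
    moreover have nonneg: "0 \<le> ln (1 / \<rho>\<^sup>2)" "0 \<le> 2 * log_weight (z + w) ^ m"
      using l log_weight_nonneg[OF inD(1)[OF that]] by simp_all
    ultimately have "2 * ln (1 / \<rho>\<^sup>2) ^ m / \<rho>\<^sup>2 \<le> 2 * log_weight (z + w) ^ m / (cmod (z + w))\<^sup>2"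
      using pos inD[OF that] by (intro frac_le mult_left_mono power_mono nonneg) auto
    then show ?thesis
      using inD[OF that] by (simp add: c_def weight_def)
  qed
  \<comment> \<open>The centre is moved to the origin to allow averaging over rotations, and the
    square is holomorphic, unlike |f|^2, so each circle average is given by Cauchy's
    formula.\<close>
  define F where "F w = indicator (ball 0 r) w *\<^sub>R (f (z + w))\<^sup>2" for w
  have hol: "(\<lambda>w. (f (z + w))\<^sup>2) holomorphic_on ball 0 r"
  proof -
    have "(\<lambda>w. z + w) ` ball 0 r \<subseteq> punctured_disc"
      using inD by blast
    then have "(f \<circ> (\<lambda>w. z + w)) holomorphic_on ball 0 r"
      by (intro holomorphic_on_compose_gen[OF _ bergman_space_holomorphic[OF f]] holomorphic_intros)
    then show ?thesis
      by (auto simp: o_def intro: holomorphic_intros)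
  qed
  have Fm: "F \<in> borel_measurable lborel"
    unfolding F_def using borel_measurable_continuous_on_indicator[OF _ holomorphic_on_imp_continuous_on[OF hol]]
    by simp
  have G: "integrable lborel (\<lambda>w. weight m (z + w) * (cmod (f (z + w)))\<^sup>2)"
    "(LINT w|lborel. weight m (z + w) * (cmod (f (z + w)))\<^sup>2) = (bergman_norm (m + 2) f)\<^sup>2"
    using bergman_space_integrable[OF f] integrable_distr_eq[of "(+) z" lborel borel "\<lambda>z. weight m z * (cmod (f z))\<^sup>2"]
      integral_distr[of "(+) z" lborel borel "\<lambda>z. weight m z * (cmod (f z))\<^sup>2"]
    by (auto simp: lborel_distr_plus bergman_norm2_eq[OF f])
  have le: "norm (F w) \<le> 1 / c * (weight m (z + w) * (cmod (f (z + w)))\<^sup>2)" for w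
  proof (cases "w \<in> ball 0 r")
    case True
    then have "c * (cmod (f (z + w)))\<^sup>2 \<le> weight m (z + w) * (cmod (f (z + w)))\<^sup>2"
      by (intro mult_right_mono weight_ge) auto
    then show ?thesis
      using True c by (simp add: F_def norm_power field_simps)
  qed (use c in \<open>simp add: F_def\<close>)
  have F: "integrable lborel F"
    by (rule Bochner_Integration.integrable_bound[OF integrable_mult_right[OF G(1), of "1 / c"] Fm])
       (use le c in \<open>auto simp: abs_mult\<close>)
  have avg: "(LBINT t:{0..1}. F (w * cis (2 * pi * t))) = indicator (ball 0 r) w *\<^sub>R (f z)\<^sup>2" for w
  proof (cases "w \<in> ball 0 r")
    case True
    then show ?thesis
      using circle_average[OF hol, of w 0] by (simp add: F_def norm_mult)
  qed (simp add: F_def norm_mult set_lebesgue_integral_def)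
  have "pi * r\<^sup>2 * (cmod (f z))\<^sup>2 = norm (integral\<^sup>L lborel F)"
  proof -
    have "integral\<^sup>L lborel F = (LINT w::complex|lborel. indicator (ball 0 r) w *\<^sub>R (f z)\<^sup>2)"
      using integral_rotation_average[OF F, symmetric] by (simp only: avg)
    also have "\<dots> = (pi * r\<^sup>2) *\<^sub>R (f z)\<^sup>2"
      using r emeasure_complex_ball[of r 0] by (simp add: measure_def)
    finally show ?thesis
      using r by (simp add: norm_power)
  qed
  also have "\<dots> \<le> (LINT w::complex|lborel. 1 / c * (weight m (z + w) * (cmod (f (z + w)))\<^sup>2))"
    by (intro Bochner_Integration.integral_norm_bound_integral F integrable_mult_right G le)
  also have "\<dots> = 1 / c * (bergman_norm (m + 2) f)\<^sup>2"
    unfolding integral_mult_right_zero G(2) ..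
  finally have *: "pi * r\<^sup>2 * (cmod (f z))\<^sup>2 \<le> 1 / c * (bergman_norm (m + 2) f)\<^sup>2" .
  have "(cmod (f z))\<^sup>2 \<le> 1 / c * (bergman_norm (m + 2) f)\<^sup>2 / (pi * r\<^sup>2)"
    using * r by (subst pos_le_divide_eq) (auto simp: mult.commute)
  also have "\<dots> = \<rho>\<^sup>2 / (2 * pi * r\<^sup>2 * ln (1 / \<rho>\<^sup>2) ^ m) * (bergman_norm (m + 2) f)\<^sup>2"
    by (simp add: c_def mult_ac)
  finally show ?thesis .
qed

text \<open>A crude constant suffices: it makes the kernel sums converge and controls an
  approximation error that tends to 0.\<close>

lemma bergman_evaluation_bounded:
  assumes "z \<in> punctured_disc"
  shows "\<exists>C>0. \<forall>f\<in>bergman_space (m + 2). (cmod (f z))\<^sup>2 \<le> C * (bergman_norm (m + 2) f)\<^sup>2"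
proof -
  \<comment> \<open>Half the distance from z to the puncture or the unit circle, whichever is
    nearer.\<close>
  define r where "r = min (cmod z) (1 - cmod z) / 2"
  have r: "0 < r" "r < cmod z" "cmod z + r < 1"
    using assms by (auto simp: r_def punctured_disc_def min_def field_simps)
  define \<rho> where "\<rho> = cmod z + r"
  have \<rho>: "0 < \<rho>" "\<rho> < 1" using r by (auto simp: \<rho>_def)
  then have "0 < ln (1 / \<rho>\<^sup>2)"
    by (intro ln_gt_zero) (simp add: power_less_one_iff field_simps)
  then have "0 < \<rho>\<^sup>2 / (2 * pi * r\<^sup>2 * ln (1 / \<rho>\<^sup>2) ^ m)"
    using \<rho> r by simp
  then show ?thesis
    using bergman_mean_value_bound[OF _ r] unfolding \<rho>_def by blast
qed

text \<open>With r = |z| / 2 the quotient of \<rho>^2 by r^2 is the constant 9, while the logarithm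
  in the denominator grows without bound at the puncture and has positive exponent m. So f tends to
  0 there and the singularity is removable with value 0.\<close>

lemma bergman_space_extension:
  assumes f: "f \<in> bergman_space (m + 2)" and m: "0 < m"
  shows "(\<lambda>z. if z = 0 then 0 else f z) holomorphic_on ball 0 1"
proof (rule no_isolated_singularity'[of "{0}"])
  let ?g = "\<lambda>z. if z = 0 then 0 else f z"
  define N where "N = (bergman_norm (m + 2) f)\<^sup>2"
  define B where "B x = sqrt (9 / (2 * pi * ln (1 / (3 / 2 * x)\<^sup>2)) * N)" for x :: real
  have bound: "cmod (?g z) \<le> B (cmod z)" if z: "0 < cmod z" "cmod z < 1 / 3" for z
  proof -
    have \<rho>: "cmod z + cmod z / 2 = 3 / 2 * cmod z" by simp
    let ?l = "ln (1 / (3 / 2 * cmod z)\<^sup>2)"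
    \<comment> \<open>The radius 1/3 makes \<rho> < 1/2, so the argument of the logarithm is at
      least 4 > e. Then \<open>?l\<close> is at least 1, and its m-th power may be replaced by
      \<open>?l\<close>.\<close>
    have "(3 / 2 * cmod z)\<^sup>2 \<le> (1 / 2)\<^sup>2"
      using z by (intro power_mono) auto
    then have "4 \<le> 1 / (3 / 2 * cmod z)\<^sup>2"
      using z by (simp add: field_simps)
    then have "exp 1 \<le> 1 / (3 / 2 * cmod z)\<^sup>2"
      using exp_le by linarith
    then have "1 \<le> ?l"
      using z by (subst ln_ge_iff) auto
    then have "?l \<le> ?l ^ m"
      using m power_increasing[of 1 m ?l] by simp
    then have "9 / (2 * pi * ?l ^ m) * N \<le> 9 / (2 * pi * ?l) * N"
      using \<open>1 \<le> ?l\<close> by (intro mult_right_mono divide_left_mono mult_left_mono mult_pos_pos) (auto simp: N_def)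
    moreover have "(3 / 2 * cmod z)\<^sup>2 / (2 * pi * (cmod z / 2)\<^sup>2 * ?l ^ m) = 9 / (2 * pi * ?l ^ m)"
      using z by (simp add: field_simps)
    moreover have "(cmod (f z))\<^sup>2 \<le> (3 / 2 * cmod z)\<^sup>2 / (2 * pi * (cmod z / 2)\<^sup>2 * ?l ^ m) * N"
      using bergman_mean_value_bound[OF f, of "cmod z / 2" z] z unfolding \<rho> N_def by simp
    ultimately have "(cmod (f z))\<^sup>2 \<le> 9 / (2 * pi * ?l) * N" by simp
    then show ?thesis
      using z unfolding B_def by (auto intro: real_le_rsqrt)
  qed
  have "(B \<longlongrightarrow> 0) (at_right 0)"
  proof -
    have "((\<lambda>x::real. 9 / (2 * pi * ln (1 / (3 / 2 * x)\<^sup>2))) \<longlongrightarrow> 0) (at_right 0)"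
      by real_asymp
    from tendsto_real_sqrt[OF tendsto_mult_right[OF this, of N]] show ?thesis
      by (simp add: B_def[abs_def])
  qed
  moreover have "filterlim cmod (at_right 0) (at 0)"
    unfolding filterlim_at by (auto simp: eventually_at_filter intro!: tendsto_eq_intros)
  ultimately have "((\<lambda>z. B (cmod z)) \<longlongrightarrow> 0) (at 0)"
    by (rule filterlim_compose)
  moreover have "\<forall>\<^sub>F z in at 0. norm (?g z) \<le> B (cmod z)"
    unfolding eventually_at using bound by (intro exI[of _ "1 / 3"]) (auto simp: dist_norm)
  ultimately have "(?g \<longlongrightarrow> 0) (at 0)"
    by (rule Lim_null_comparison[rotated])
  then show "(?g \<longlongrightarrow> ?g z) (at z within ball 0 1)" if "z \<in> {0}" for z
    using that by (auto intro: tendsto_within_subset)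
  have "ball 0 1 - {0} = punctured_disc"
    by (auto simp: punctured_disc_def)
  moreover have "?g holomorphic_on punctured_disc"
    by (rule holomorphic_transform[OF bergman_space_holomorphic[OF f]]) (auto simp: punctured_disc_def)
  ultimately show "?g holomorphic_on ball 0 1 - {0}" by simp
qed auto

section \<open>Orthonormal bases and the kernel\<close>

lemma power_in_bergman_space:
  assumes "0 < n"
  shows "(\<lambda>z. z ^ n) \<in> bergman_space (m + 2)"
  unfolding bergman_space_iff
  using nn_integral_weight_monomial[OF assms, of m]
  by (auto intro!: holomorphic_intros integrableI_nonneg)

lemma bergman_norm2_power:
  assumes "0 < n"
  shows "(bergman_norm (m + 2) (\<lambda>z. z ^ n))\<^sup>2 = monomial_norm2 m n"
  unfolding bergman_norm2_eq[OF power_in_bergman_space[OF assms]]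
  using nn_integral_weight_monomial[OF assms, of m] monomial_norm2_pos[OF assms, of m]
  by (intro integral_eq_nn_integral[THEN trans]) auto

text \<open>Averaging over rotations picks the \<open>n\<close>-th Taylor coefficient.\<close>

lemma bergman_inner_power:
  assumes f: "f \<in> bergman_space (m + 2)" and n: "0 < n"
    and g: "g holomorphic_on ball 0 1" "\<And>z. z \<in> punctured_disc \<Longrightarrow> f z = g z"
  shows "bergman_inner (m + 2) f (\<lambda>z. z ^ n) = (deriv ^^ n) g 0 / fact n * of_real (monomial_norm2 m n)"
proof -
  define a where "a = (deriv ^^ n) g 0 / fact n"
  define F where "F z = weight m z *\<^sub>R (f z * cnj (z ^ n))" for z
  note p = power_in_bergman_space[OF n, of m]
  have F: "integrable lborel F"
    unfolding F_def by (rule integrable_weight_mult_cnj[OF f p])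
  have avg: "(LBINT t:{0..1}. F (z * cis (2 * pi * t))) = a * (weight m z *\<^sub>R (z ^ n * cnj (z ^ n)))" for z
  proof (cases "z \<in> punctured_disc")
    case True
    then have inD: "z * cis (2 * pi * t) \<in> punctured_disc" for t
      by (simp add: punctured_disc_def norm_mult)
    have "F (z * cis (2 * pi * t)) = (weight m z *\<^sub>R cnj (z ^ n)) *
        (g (z * cis (2 * pi * t)) * cnj (cis (2 * pi * t)) ^ n)" for t
      by (simp only: F_def weight_rotate norm_cis g(2)[OF inD]) (simp add: power_mult_distrib mult_ac)
    then have "(LBINT t:{0..1}. F (z * cis (2 * pi * t)))
        = (weight m z *\<^sub>R cnj (z ^ n)) * (LBINT t:{0..1}. g (z * cis (2 * pi * t)) * cnj (cis (2 * pi * t)) ^ n)"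
      by (simp only: set_integral_mult_right)
    then show ?thesis
      using circle_average[OF g(1), of z n] True by (simp add: a_def punctured_disc_def mult_ac)
  next
    case False
    then have "F (z * cis (2 * pi * t)) = 0" for t
      by (simp add: F_def weight_rotate weight_outside)
    then show ?thesis
      using False by (simp add: set_lebesgue_integral_def weight_outside)
  qed
  have "bergman_inner (m + 2) f (\<lambda>z. z ^ n) = integral\<^sup>L lborel F"
    unfolding bergman_inner_eq[OF f p] F_def ..
  also have "\<dots> = (LINT z|lborel. a * (weight m z *\<^sub>R (z ^ n * cnj (z ^ n))))"
    using integral_rotation_average[OF F, symmetric] by (simp only: avg)
  also have "\<dots> = a * bergman_inner (m + 2) (\<lambda>z. z ^ n) (\<lambda>z. z ^ n)"
    unfolding integral_mult_right_zero bergman_inner_eq[OF p p] ..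
  finally show ?thesis
    unfolding bergman_inner_self[OF p] bergman_norm2_power[OF n] a_def .
qed

text \<open>Index n carries the exponent n + 1: for positive m, functions of the space vanish at the
  puncture, so no constant term occurs.\<close>

definition bergman_monomial :: "nat \<Rightarrow> nat \<Rightarrow> complex \<Rightarrow> complex" where
  "bergman_monomial m n z = of_real (1 / sqrt (monomial_norm2 m (Suc n))) * z ^ Suc n"

lemma bergman_monomial_in_space: "bergman_monomial m n \<in> bergman_space (m + 2)"
  unfolding bergman_monomial_def[abs_def]
  by (intro bergman_space_scale power_in_bergman_space) simp

lemma bergman_inner_scale_left:
  assumes "f \<in> bergman_space (m + 2)" "g \<in> bergman_space (m + 2)"
  shows "bergman_inner (m + 2) (\<lambda>z. c * f z) g = c * bergman_inner (m + 2) f g"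
  using bergman_inner_sum_left[of "{()}" "\<lambda>_. f" m g "\<lambda>_. c"] assms by simp

lemma bergman_inner_scale_right:
  assumes "f \<in> bergman_space (m + 2)" "g \<in> bergman_space (m + 2)"
  shows "bergman_inner (m + 2) f (\<lambda>z. c * g z) = cnj c * bergman_inner (m + 2) f g"
  using bergman_inner_cnj[OF bergman_space_scale[OF assms(2), of c] assms(1)]
    bergman_inner_cnj[OF assms(2,1)] by (simp add: bergman_inner_scale_left assms)

text \<open>Normalising divides the squared norm of the power by its root: a Fourier coefficient is
  the Taylor coefficient times the norm of the power.\<close>

lemma bergman_inner_monomial:
  assumes f: "f \<in> bergman_space (m + 2)"
    and g: "g holomorphic_on ball 0 1" "\<And>z. z \<in> punctured_disc \<Longrightarrow> f z = g z"
  shows "bergman_inner (m + 2) f (bergman_monomial m n)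
    = (deriv ^^ Suc n) g 0 / fact (Suc n) * of_real (sqrt (monomial_norm2 m (Suc n)))"
proof -
  let ?N = "monomial_norm2 m (Suc n)"
  have "1 / sqrt ?N * ?N = sqrt ?N"
    using monomial_norm2_pos[of "Suc n" m] by (simp add: real_div_sqrt)
  then have N: "complex_of_real (1 / sqrt ?N) * of_real ?N = of_real (sqrt ?N)"
    by (metis of_real_mult)
  have "bergman_inner (m + 2) f (bergman_monomial m n)
      = of_real (1 / sqrt ?N) * ((deriv ^^ Suc n) g 0 / fact (Suc n) * of_real ?N)"
    unfolding bergman_monomial_def[abs_def]
    by (simp only: bergman_inner_scale_right[OF f power_in_bergman_space[OF zero_less_Suc]]
        bergman_inner_power[OF f zero_less_Suc g] complex_cnj_complex_of_real)
  also have "\<dots> = (deriv ^^ Suc n) g 0 / fact (Suc n) * (of_real (1 / sqrt ?N) * of_real ?N)"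
    by (simp only: mult_ac)
  finally show ?thesis
    unfolding N .
qed

lemma bergman_monomial_orthonormal: "bergman_orthonormal (m + 2) (bergman_monomial m)"
  unfolding bergman_orthonormal_def
proof (intro conjI allI)
  fix i j
  let ?N = "\<lambda>n. monomial_norm2 m (Suc n)"
  show "bergman_monomial m i \<in> bergman_space (m + 2)"
    by (rule bergman_monomial_in_space)
  have hol: "(\<lambda>z::complex. z ^ Suc i) holomorphic_on ball 0 1"
    by (intro holomorphic_intros)
  \<comment> \<open>For j < i a positive power of 0 remains, for j > i the Pochhammer factor starts
    at 0, and for i = j it is the factorial.\<close>
  have "(deriv ^^ Suc j) (\<lambda>z. (z - 0) ^ Suc i) (0::complex) / fact (Suc j) = (if i = j then 1 else 0)"
    unfolding higher_deriv_power
    by (cases i j rule: linorder_cases) (auto simp: pochhammer_same pochhammer_0_left pochhammer_fact[symmetric] simp del: fact_Suc)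
  then have "bergman_inner (m + 2) (\<lambda>z. z ^ Suc i) (bergman_monomial m j)
      = (if i = j then of_real (sqrt (?N i)) else 0)"
    using bergman_inner_monomial[OF power_in_bergman_space[OF zero_less_Suc] hol, where m = m and n = j]
    by (auto simp del: power_Suc fact_Suc funpow.simps)
  then show "bergman_inner (m + 2) (bergman_monomial m i) (bergman_monomial m j) = (if i = j then 1 else 0)"
    unfolding bergman_monomial_def[of m i, abs_def]
      bergman_inner_scale_left[OF power_in_bergman_space[OF zero_less_Suc] bergman_monomial_in_space]
    using monomial_norm2_pos[of "Suc i" m] by (auto simp flip: of_real_mult)
qed

text \<open>Fatou's lemma bounds the norm of a remainder of the Taylor series by the tail of the
  coefficients, which Bessel's inequality controls.\<close>

lemma bergman_norm2_le_of_partial_sums: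
  assumes e: "bergman_orthonormal (m + 2) e" and h: "h \<in> bergman_space (m + 2)"
    and lim: "\<And>z. z \<in> punctured_disc \<Longrightarrow> (\<lambda>n. \<Sum>i\<in>{N..<n}. d i * e i z) \<longlonglongrightarrow> h z"
    and bound: "\<And>n. (\<Sum>i\<in>{N..<n}. (cmod (d i))\<^sup>2) \<le> T"
  shows "(bergman_norm (m + 2) h)\<^sup>2 \<le> T"
proof -
  let ?s = "\<lambda>n z. \<Sum>i\<in>{N..<n}. d i * e i z"
  have s: "?s n \<in> bergman_space (m + 2)" for n
    using e by (intro bergman_space_sum) (simp add: bergman_orthonormal_def)
  have T: "0 \<le> T" using bound[of 0] by simp
  have nn: "(\<integral>\<^sup>+z. ennreal (weight m z * (cmod (f z))\<^sup>2) \<partial>lborel) = ennreal ((bergman_norm (m + 2) f)\<^sup>2)"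
    if "f \<in> bergman_space (m + 2)" for f
    using bergman_space_integrable[OF that] by (simp add: bergman_norm2_eq[OF that] nn_integral_eq_integral)
  have lm: "(\<lambda>n. ennreal (weight m z * (cmod (?s n z))\<^sup>2)) \<longlonglongrightarrow> ennreal (weight m z * (cmod (h z))\<^sup>2)" for z
  proof (cases "z \<in> punctured_disc")
    case True
    then show ?thesis
      by (intro tendsto_ennrealI tendsto_intros lim)
  qed (simp add: weight_outside)
  have meas: "(\<lambda>z. ennreal (weight m z * (cmod (?s n z))\<^sup>2)) \<in> borel_measurable lborel" for n
    using bergman_space_integrable[OF s, of n] by measurable
  have "(\<integral>\<^sup>+z. ennreal (weight m z * (cmod (h z))\<^sup>2) \<partial>lborel)
      = (\<integral>\<^sup>+z. liminf (\<lambda>n. ennreal (weight m z * (cmod (?s n z))\<^sup>2)) \<partial>lborel)"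
    using lim_imp_Liminf[OF _ lm] by simp
  also have "\<dots> \<le> liminf (\<lambda>n. \<integral>\<^sup>+z. ennreal (weight m z * (cmod (?s n z))\<^sup>2) \<partial>lborel)"
    by (rule nn_integral_liminf[OF meas])
  also have "\<dots> \<le> ennreal T"
    by (intro Liminf_le) (simp_all add: nn[OF s] bergman_norm2_orthonormal_sum[OF e] bound ennreal_leI)
  finally show ?thesis
    unfolding nn[OF h] using T by (simp add: ennreal_le_iff)
qed

text \<open>Pointwise, the Fourier expansion is the Taylor expansion of the extension g. By Bessel
  the squared coefficients are summable; N is chosen so that their tail is below the square of
  \<epsilon>, and this tail bounds the squared norm of the remainder.\<close>

lemma bergman_monomial_onb:
  assumes m: "0 < m"
  shows "bergman_onb (m + 2) (bergman_monomial m)"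
  unfolding bergman_onb_def
proof (intro conjI ballI allI impI)
  let ?e = "bergman_monomial m"
  note e = bergman_monomial_orthonormal[of m]
  show "?e i \<in> bergman_space (m + 2)" for i
    by (rule bergman_monomial_in_space)
  show "bergman_inner (m + 2) (?e i) (?e j) = (if i = j then 1 else 0)" for i j
    using e unfolding bergman_orthonormal_def by blast
  fix f and \<epsilon> :: real
  assume f: "f \<in> bergman_space (m + 2)" and \<epsilon>: "0 < \<epsilon>"
  define g where "g z = (if z = 0 then 0 else f z)" for z
  have g: "g holomorphic_on ball 0 1"
    using bergman_space_extension[OF f m] unfolding g_def[abs_def] .
  have fg: "f z = g z" if "z \<in> punctured_disc" for z
    using that by (simp add: g_def punctured_disc_def)
  define d where "d n = bergman_inner (m + 2) f (?e n)" for n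
  have series: "(\<lambda>n. d n * ?e n z) sums f z" if z: "z \<in> punctured_disc" for z
  proof -
    define a where "a n = (deriv ^^ n) g 0 / fact n" for n
    have de: "d n * ?e n z = a (Suc n) * z ^ Suc n" for n
    proof -
      have "complex_of_real (sqrt (monomial_norm2 m (Suc n))) * of_real (1 / sqrt (monomial_norm2 m (Suc n))) = 1"
        using monomial_norm2_pos[of "Suc n" m] by (simp flip: of_real_mult)
      moreover have dn: "d n = (deriv ^^ Suc n) g 0 / fact (Suc n) * of_real (sqrt (monomial_norm2 m (Suc n)))"
        unfolding d_def by (rule bergman_inner_monomial[OF f g]) (rule fg)
      moreover have "d n * ?e n z = a (Suc n) * z ^ Suc n *
          (of_real (sqrt (monomial_norm2 m (Suc n))) * of_real (1 / sqrt (monomial_norm2 m (Suc n))))"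
        unfolding dn bergman_monomial_def a_def by (simp only: mult_ac)
      ultimately show ?thesis
        by (simp only: mult_1_right)
    qed
    have "(\<lambda>n. a n * (z - 0) ^ n) sums g z"
      unfolding a_def using z by (intro holomorphic_power_series[OF g]) (simp add: punctured_disc_def)
    then have "(\<lambda>n. a n * z ^ n) sums f z"
      using fg[OF z] by simp
    \<comment> \<open>The zero of g at the puncture removes the constant term, so the index shift
      loses nothing.\<close>
    moreover have "a 0 = 0" by (simp add: a_def g_def)
    ultimately show ?thesis
      unfolding de by (subst sums_Suc_iff) simp
  qed
  define B where "B = (bergman_norm (m + 2) f)\<^sup>2"
  have bessel: "(\<Sum>i\<in>I. (cmod (d i))\<^sup>2) \<le> B" if "finite I" for I
    unfolding d_def B_def by (rule bergman_bessel[OF e f that])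
  have sm: "summable (\<lambda>i. (cmod (d i))\<^sup>2)"
    using bessel by (intro summableI_nonneg_bounded[of _ B]) auto
  have "(\<lambda>N. \<Sum>i. (cmod (d (i + N)))\<^sup>2) \<longlonglongrightarrow> 0"
    by (rule suminf_exist_split2[OF sm])
  then have "\<forall>\<^sub>F N in sequentially. (\<Sum>i. (cmod (d (i + N)))\<^sup>2) < \<epsilon>\<^sup>2"
    using \<epsilon> by (intro order_tendstoD) auto
  then obtain N where N: "(\<Sum>i. (cmod (d (i + N)))\<^sup>2) < \<epsilon>\<^sup>2"
    by (auto simp: eventually_sequentially)
  let ?h = "\<lambda>z. f z - (\<Sum>i<N. d i * ?e i z)"
  have h: "?h \<in> bergman_space (m + 2)"
    by (intro bergman_space_diff f bergman_space_sum bergman_monomial_in_space)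
  have "(bergman_norm (m + 2) ?h)\<^sup>2 \<le> (\<Sum>i. (cmod (d (i + N)))\<^sup>2)"
  proof (rule bergman_norm2_le_of_partial_sums[OF e h])
    fix z assume "z \<in> punctured_disc"
    from series[OF this] have "(\<lambda>n. (\<Sum>i<n. d i * ?e i z) - (\<Sum>i<N. d i * ?e i z)) \<longlonglongrightarrow> ?h z"
      unfolding sums_def by (intro tendsto_intros)
    moreover have "\<forall>\<^sub>F n in sequentially. (\<Sum>i<n. d i * ?e i z) - (\<Sum>i<N. d i * ?e i z)
        = (\<Sum>i\<in>{N..<n}. d i * ?e i z)"
      using eventually_ge_at_top[of N]
    proof eventually_elim
      case (elim n)
      then show ?case
        using sum.atLeastLessThan_concat[of 0 N n "\<lambda>i. d i * ?e i z"] by (simp add: atLeast0LessThan diff_eq_eq add.commute)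
    qed
    ultimately show "(\<lambda>n. \<Sum>i\<in>{N..<n}. d i * ?e i z) \<longlonglongrightarrow> ?h z"
      by (rule Lim_transform_eventually)
  next
    fix n
    have "(\<Sum>i\<in>{N..<n}. (cmod (d i))\<^sup>2) = (\<Sum>i<n - N. (cmod (d (i + N)))\<^sup>2)"
      by (rule sum.reindex_bij_witness[of _ "\<lambda>i. i + N" "\<lambda>i. i - N"]) auto
    also have "\<dots> \<le> (\<Sum>i. (cmod (d (i + N)))\<^sup>2)"
      using summable_ignore_initial_segment[OF sm, of N] by (intro sum_le_suminf) auto
    finally show "(\<Sum>i\<in>{N..<n}. (cmod (d i))\<^sup>2) \<le> (\<Sum>i. (cmod (d (i + N)))\<^sup>2)" .
  qed
  then have "bergman_norm (m + 2) ?h < \<epsilon>"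
    using N \<epsilon> by (intro power2_less_imp_less[of _ \<epsilon>]) auto
  then show "\<exists>n c. bergman_norm (m + 2) (\<lambda>z. f z - (\<Sum>i<n. c i * ?e i z)) < \<epsilon>"
    by blast
qed

section \<open>Independence of the kernel sum from the basis\<close>

text \<open>Young's inequality, from the nonnegative square of
  \<open>\<delta> * cmod a - cmod b\<close>. It does the work of a triangle inequality while staying
  with squares; the factor of the main term tends to 1 with \<delta> -> 0.\<close>

lemma cmod_add_square_le:
  assumes "0 < \<delta>"
  shows "(cmod (a + b))\<^sup>2 \<le> (1 + \<delta>) * (cmod a)\<^sup>2 + (1 + 1 / \<delta>) * (cmod b)\<^sup>2"
proof -
  have "(cmod (a + b))\<^sup>2 \<le> (cmod a + cmod b)\<^sup>2"
    by (intro power_mono norm_triangle_ineq) auto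
  moreover have "0 \<le> (\<delta> * cmod a - cmod b)\<^sup>2 / \<delta>"
    using assms by simp
  moreover have "(\<delta> * cmod a - cmod b)\<^sup>2 / \<delta> = \<delta> * (cmod a)\<^sup>2 + (cmod b)\<^sup>2 / \<delta> - 2 * cmod a * cmod b"
    using assms by (simp add: power2_eq_square field_simps)
  ultimately show ?thesis
    by (simp add: power2_eq_square algebra_simps)
qed

lemma bergman_norm2_add_le:
  assumes f: "f \<in> bergman_space (m + 2)" and g: "g \<in> bergman_space (m + 2)" and "0 < \<delta>"
  shows "(bergman_norm (m + 2) (\<lambda>z. f z + g z))\<^sup>2
    \<le> (1 + \<delta>) * (bergman_norm (m + 2) f)\<^sup>2 + (1 + 1 / \<delta>) * (bergman_norm (m + 2) g)\<^sup>2"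
proof -
  note If = bergman_space_integrable[OF f] and Ig = bergman_space_integrable[OF g]
  have "(LINT z|lborel. weight m z * (cmod (f z + g z))\<^sup>2)
      \<le> (LINT z|lborel. (1 + \<delta>) * (weight m z * (cmod (f z))\<^sup>2) + (1 + 1 / \<delta>) * (weight m z * (cmod (g z))\<^sup>2))"
  proof (rule integral_mono)
    show "integrable lborel (\<lambda>z. weight m z * (cmod (f z + g z))\<^sup>2)"
      by (rule bergman_space_integrable[OF bergman_space_add[OF f g]])
    show "integrable lborel (\<lambda>z. (1 + \<delta>) * (weight m z * (cmod (f z))\<^sup>2) + (1 + 1 / \<delta>) * (weight m z * (cmod (g z))\<^sup>2))"
      using If Ig by (intro Bochner_Integration.integrable_add integrable_mult_right)
    show "weight m z * (cmod (f z + g z))\<^sup>2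
        \<le> (1 + \<delta>) * (weight m z * (cmod (f z))\<^sup>2) + (1 + 1 / \<delta>) * (weight m z * (cmod (g z))\<^sup>2)" for z
      using mult_left_mono[OF cmod_add_square_le[OF assms(3), of "f z" "g z"] weight_nonneg[of m z]]
      by (simp only: distrib_left mult.left_commute)
  qed
  also have "\<dots> = (1 + \<delta>) * (LINT z|lborel. weight m z * (cmod (f z))\<^sup>2)
      + (1 + 1 / \<delta>) * (LINT z|lborel. weight m z * (cmod (g z))\<^sup>2)"
    by (subst Bochner_Integration.integral_add)
       (simp_all only: integrable_mult_right[OF If] integrable_mult_right[OF Ig] integral_mult_right_zero)
  finally show ?thesis
    unfolding bergman_norm2_eq[OF f] bergman_norm2_eq[OF g] bergman_norm2_eq[OF bergman_space_add[OF f g]] .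
qed

lemma bergman_onb_orthonormal: "bergman_onb k f \<Longrightarrow> bergman_orthonormal k f"
  unfolding bergman_onb_def bergman_orthonormal_def by blast

text \<open>The sum \<open>\<Sum>i. |f i z|\<^sup>2\<close> is the least constant \<open>S\<close> with \<open>|g z|\<^sup>2 \<le> S * \<parallel>g\<parallel>\<^sup>2\<close>, hence the same
  for all orthonormal bases.\<close>

lemma bergman_orthonormal_partial_sum_le:
  assumes f: "bergman_orthonormal (m + 2) f"
    and S: "\<And>g. g \<in> bergman_space (m + 2) \<Longrightarrow> (cmod (g z))\<^sup>2 \<le> S * (bergman_norm (m + 2) g)\<^sup>2"
  shows "(\<Sum>i<n. (cmod (f i z))\<^sup>2) \<le> S"
proof -
  define P where "P = (\<Sum>i<n. (cmod (f i z))\<^sup>2)"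
  \<comment> \<open>The extremal function: the reproducing kernel at z of the span of the first n
    members. Its value at z and its squared norm are both P, so the hypothesis reads P^2 <= S
    P.\<close>
  define g where "g w = (\<Sum>i<n. cnj (f i z) * f i w)" for w
  have g: "g \<in> bergman_space (m + 2)"
    unfolding g_def[abs_def] using f by (intro bergman_space_sum) (simp add: bergman_orthonormal_def)
  have "(bergman_norm (m + 2) g)\<^sup>2 = P"
    unfolding g_def[abs_def] P_def by (subst bergman_norm2_orthonormal_sum[OF f]) auto
  moreover have "g z = of_real P"
    by (simp add: g_def P_def complex_norm_square[symmetric] mult.commute[of "cnj _"])
  ultimately have "P * P \<le> S * P"
    using S[OF g] by (simp add: power2_eq_square)
  moreover have "0 \<le> P"
    by (simp add: P_def sum_nonneg)
  \<comment> \<open>Covers the case P = 0, where P cannot be cancelled.\<close>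
  moreover have "0 \<le> S"
  proof -
    have "0 \<le> (cmod (f 0 z))\<^sup>2" by simp
    also have "\<dots> \<le> S * (bergman_norm (m + 2) (f 0))\<^sup>2"
      using f by (intro S) (simp add: bergman_orthonormal_def)
    also have "(bergman_norm (m + 2) (f 0))\<^sup>2 = 1"
      using bergman_norm2_orthonormal_sum[OF f, of "{0}" "\<lambda>_. 1"] by simp
    finally show ?thesis by simp
  qed
  ultimately show ?thesis
    unfolding P_def[symmetric] by (cases "P = 0") (auto simp: mult_le_cancel_right)
qed

text \<open>Density gives a finite combination p close to g in norm. Cauchy-Schwarz bounds p at z
  with the sharp constant S, the crude constant C handles the small difference q, and Young's
  inequality joins the two both at z and in norm.\<close>

lemma bergman_onb_evaluation:
  assumes f: "bergman_onb (m + 2) f" and z: "z \<in> punctured_disc"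
  defines "S \<equiv> \<Sum>i. (cmod (f i z))\<^sup>2"
  shows bergman_onb_summable: "summable (\<lambda>i. (cmod (f i z))\<^sup>2)"
    and bergman_onb_evaluation_le:
      "g \<in> bergman_space (m + 2) \<Longrightarrow> (cmod (g z))\<^sup>2 \<le> S * (bergman_norm (m + 2) g)\<^sup>2"
proof -
  note orth = bergman_onb_orthonormal[OF f]
  obtain C where C: "0 < C" "\<And>h. h \<in> bergman_space (m + 2) \<Longrightarrow> (cmod (h z))\<^sup>2 \<le> C * (bergman_norm (m + 2) h)\<^sup>2"
    using bergman_evaluation_bounded[OF z] by blast
  show sm: "summable (\<lambda>i. (cmod (f i z))\<^sup>2)"
    using bergman_orthonormal_partial_sum_le[OF orth C(2)] by (intro summableI_nonneg_bounded[of _ C]) auto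
  have S: "0 \<le> S"
    unfolding S_def by (intro suminf_nonneg sm) auto
  assume g: "g \<in> bergman_space (m + 2)"
  define G where "G = (bergman_norm (m + 2) g)\<^sup>2"
  have approx: "(cmod (g z))\<^sup>2 \<le> (1 + \<delta>) * (S * ((1 + \<delta>) * G + (1 + 1 / \<delta>) * \<epsilon>\<^sup>2)) + (1 + 1 / \<delta>) * (C * \<epsilon>\<^sup>2)"
    if \<delta>: "0 < \<delta>" and \<epsilon>: "0 < \<epsilon>" for \<delta> \<epsilon> :: real
  proof -
    obtain n c where nc: "bergman_norm (m + 2) (\<lambda>z. g z - (\<Sum>i<n. c i * f i z)) < \<epsilon>"
      using f g \<epsilon> unfolding bergman_onb_def by blast
    define p where "p w = (\<Sum>i<n. c i * f i w)" for w
    define q where "q w = g w - p w" for w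
    have p: "p \<in> bergman_space (m + 2)"
      unfolding p_def[abs_def] using orth by (intro bergman_space_sum) (simp add: bergman_orthonormal_def)
    have q: "q \<in> bergman_space (m + 2)"
      unfolding q_def[abs_def] by (rule bergman_space_diff[OF g p])
    have q': "(\<lambda>z. (-1) * q z) \<in> bergman_space (m + 2)"
      by (rule bergman_space_scale[OF q])
    have qn: "(bergman_norm (m + 2) q)\<^sup>2 \<le> \<epsilon>\<^sup>2"
      using nc bergman_norm_nonneg[OF q] by (intro power_mono) (auto simp: q_def[abs_def] p_def)
    have "(bergman_norm (m + 2) (\<lambda>z. (-1) * q z))\<^sup>2 = (bergman_norm (m + 2) q)\<^sup>2"
      unfolding bergman_norm2_eq[OF q] bergman_norm2_eq[OF q'] by simp
    moreover have "p = (\<lambda>z. g z + (-1) * q z)"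
      by (auto simp: q_def)
    ultimately have pn: "(bergman_norm (m + 2) p)\<^sup>2 \<le> (1 + \<delta>) * G + (1 + 1 / \<delta>) * (bergman_norm (m + 2) q)\<^sup>2"
      using bergman_norm2_add_le[OF g q' \<delta>] by (simp add: G_def)
    also have "\<dots> \<le> (1 + \<delta>) * G + (1 + 1 / \<delta>) * \<epsilon>\<^sup>2"
      using qn \<delta> by (intro add_left_mono mult_left_mono) auto
    finally have pn: "(bergman_norm (m + 2) p)\<^sup>2 \<le> (1 + \<delta>) * G + (1 + 1 / \<delta>) * \<epsilon>\<^sup>2" .
    have "(cmod (p z))\<^sup>2 \<le> (\<Sum>i<n. (cmod (c i))\<^sup>2) * (\<Sum>i<n. (cmod (f i z))\<^sup>2)"
    proof -
      have "cmod (p z) \<le> (\<Sum>i<n. cmod (c i) * cmod (f i z))"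
        unfolding p_def by (rule order.trans[OF norm_sum]) (simp add: norm_mult)
      then have "(cmod (p z))\<^sup>2 \<le> (\<Sum>i<n. cmod (c i) * cmod (f i z))\<^sup>2"
        by (intro power_mono) auto
      also have "\<dots> \<le> (\<Sum>i<n. (cmod (c i))\<^sup>2) * (\<Sum>i<n. (cmod (f i z))\<^sup>2)"
        by (rule Cauchy_Schwarz_ineq_sum)
      finally show ?thesis .
    qed
    also have "\<dots> \<le> (bergman_norm (m + 2) p)\<^sup>2 * S"
      unfolding p_def[abs_def] bergman_norm2_orthonormal_sum[OF orth finite_lessThan] S_def
      by (intro mult_left_mono sum_le_suminf sm sum_nonneg) auto
    also have "\<dots> \<le> S * ((1 + \<delta>) * G + (1 + 1 / \<delta>) * \<epsilon>\<^sup>2)"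
      using pn S by (subst mult.commute) (rule mult_left_mono)
    finally have pz: "(cmod (p z))\<^sup>2 \<le> S * ((1 + \<delta>) * G + (1 + 1 / \<delta>) * \<epsilon>\<^sup>2)" .
    have qz: "(cmod (q z))\<^sup>2 \<le> C * \<epsilon>\<^sup>2"
      by (rule order.trans[OF C(2)[OF q] mult_left_mono[OF qn less_imp_le[OF C(1)]]])
    have "(cmod (g z))\<^sup>2 \<le> (1 + \<delta>) * (cmod (p z))\<^sup>2 + (1 + 1 / \<delta>) * (cmod (q z))\<^sup>2"
      using cmod_add_square_le[OF \<delta>, of "p z" "q z"] by (simp add: q_def)
    also have "\<dots> \<le> (1 + \<delta>) * (S * ((1 + \<delta>) * G + (1 + 1 / \<delta>) * \<epsilon>\<^sup>2)) + (1 + 1 / \<delta>) * (C * \<epsilon>\<^sup>2)"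
      using \<delta> by (intro add_mono mult_left_mono pz qz) auto
    finally show ?thesis .
  qed
  \<comment> \<open>The order of the limits matters: 1 + 1/\<delta> is unbounded as \<delta> -> 0,
    so \<epsilon> -> 0 is taken first with \<delta> fixed.\<close>
  have "(cmod (g z))\<^sup>2 \<le> (1 + \<delta>) * (S * ((1 + \<delta>) * G))" if \<delta>: "0 < \<delta>" for \<delta> :: real
  proof (rule tendsto_lowerbound)
    show "((\<lambda>\<epsilon>. (1 + \<delta>) * (S * ((1 + \<delta>) * G + (1 + 1 / \<delta>) * \<epsilon>\<^sup>2)) + (1 + 1 / \<delta>) * (C * \<epsilon>\<^sup>2))
        \<longlongrightarrow> (1 + \<delta>) * (S * ((1 + \<delta>) * G))) (at_right 0)"
      by (auto intro!: tendsto_eq_intros)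
    show "\<forall>\<^sub>F \<epsilon> in at_right 0. (cmod (g z))\<^sup>2
        \<le> (1 + \<delta>) * (S * ((1 + \<delta>) * G + (1 + 1 / \<delta>) * \<epsilon>\<^sup>2)) + (1 + 1 / \<delta>) * (C * \<epsilon>\<^sup>2)"
      using approx[OF \<delta>] eventually_at_right_less[of "0::real"] by (auto elim: eventually_mono)
  qed simp
  then have "\<forall>\<^sub>F \<delta> in at_right 0. (cmod (g z))\<^sup>2 \<le> (1 + \<delta>) * (S * ((1 + \<delta>) * G))"
    using eventually_at_right_less[of "0::real"] by (auto elim: eventually_mono)
  moreover have "((\<lambda>\<delta>. (1 + \<delta>) * (S * ((1 + \<delta>) * G))) \<longlongrightarrow> S * G) (at_right 0)"
    by (auto intro!: tendsto_eq_intros)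
  ultimately show "(cmod (g z))\<^sup>2 \<le> S * (bergman_norm (m + 2) g)\<^sup>2"
    unfolding G_def[symmetric] by (intro tendsto_lowerbound[of _ "S * G" "at_right 0"]) auto
qed

lemma bergman_onb_sum_unique:
  assumes "bergman_onb (m + 2) e" "bergman_onb (m + 2) f" "z \<in> punctured_disc"
  shows "(\<Sum>i. (cmod (e i z))\<^sup>2) = (\<Sum>i. (cmod (f i z))\<^sup>2)"
proof (rule antisym)
  show "(\<Sum>i. (cmod (e i z))\<^sup>2) \<le> (\<Sum>i. (cmod (f i z))\<^sup>2)"
    using assms by (intro suminf_le_const bergman_onb_summable bergman_orthonormal_partial_sum_le
        bergman_onb_orthonormal bergman_onb_evaluation_le)
  show "(\<Sum>i. (cmod (f i z))\<^sup>2) \<le> (\<Sum>i. (cmod (e i z))\<^sup>2)"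
    using assms by (intro suminf_le_const bergman_onb_summable bergman_orthonormal_partial_sum_le
        bergman_onb_orthonormal bergman_onb_evaluation_le)
qed

section \<open>The explicit kernel series and its estimates\<close>

text \<open>Since the monomials form a basis, the choice in the definition yields some basis, and
  its sum equals theirs. The reciprocals of their squared norms are the coefficients of the
  series.\<close>

theorem bergman_kernel_fun_eq:
  assumes m: "0 < m" and z: "z \<in> punctured_disc"
  shows "bergman_kernel_fun (m + 2) z
    = log_weight z ^ (m + 2) / (2 * pi * fact m) * (\<Sum>n. real (Suc n) ^ Suc m * ((cmod z)\<^sup>2) ^ Suc n)"
proof -
  note e = bergman_monomial_onb[OF m]
  have "bergman_onb (m + 2) (SOME f. bergman_onb (m + 2) f)"
    by (rule someI[of "bergman_onb (m + 2)", OF e])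
  then have "bergman_kernel_fun (m + 2) z = log_weight z ^ (m + 2) * (\<Sum>n. (cmod (bergman_monomial m n z))\<^sup>2)"
    unfolding bergman_kernel_fun_def Let_def using bergman_onb_sum_unique[OF _ e z] by simp
  also have "(\<Sum>n. (cmod (bergman_monomial m n z))\<^sup>2)
      = 1 / (2 * pi * fact m) * (\<Sum>n. real (Suc n) ^ Suc m * ((cmod z)\<^sup>2) ^ Suc n)"
  proof -
    have norm2: "(cmod (bergman_monomial m n z))\<^sup>2
        = 1 / (2 * pi * fact m) * (real (Suc n) ^ Suc m * ((cmod z)\<^sup>2) ^ Suc n)" for n
    proof -
      have "(cmod (bergman_monomial m n z))\<^sup>2 = 1 / monomial_norm2 m (Suc n) * (cmod (z ^ Suc n))\<^sup>2"
        using monomial_norm2_pos[of "Suc n" m]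
        by (simp add: bergman_monomial_def norm_mult power_mult_distrib power_divide norm_divide del: power_Suc)
      also have "(cmod (z ^ Suc n))\<^sup>2 = ((cmod z)\<^sup>2) ^ Suc n"
        unfolding norm_power by (simp only: power_mult[symmetric] mult.commute)
      finally show ?thesis
        by (simp add: monomial_norm2_def del: power_Suc)
    qed
    have "summable (\<lambda>n. real (Suc n) ^ Suc m * ((cmod z)\<^sup>2) ^ Suc n)"
      using bergman_onb_summable[OF e z] unfolding norm2 by (subst (asm) summable_cmult_iff) simp
    then show ?thesis
      unfolding norm2 by (rule suminf_mult)
  qed
  finally show ?thesis
    by (simp only: times_divide_eq_right mult_1_right times_divide_eq_left mult_1_left mult.assoc)
qed

theorem theorem1p1:
  fixes k :: nat
  assumes "k \<ge> 3"
  shows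
    "(\<forall>z::complex. 0 < cmod z \<and> cmod z \<le> exp (- real k / 2) \<longrightarrow>
        (\<exists>\<epsilon>::real. 0 < \<epsilon> \<and> \<epsilon> \<le> 2 ^ (k + 1) * (cmod z)\<^sup>2 \<and>
          bergman_kernel_fun (k + 1) z =
            ln (1 / (cmod z)\<^sup>2) ^ (k + 1) * (cmod z)\<^sup>2 / (2 * pi * fact (k - 1)) * (1 + \<epsilon>)))
     \<and>
     (\<forall>b::nat. b \<ge> 2 \<and> real k / (real b * (real b + 1)) \<ge> ln 2 \<longrightarrow>
       (\<forall>z::complex. cmod z = exp (- real k / (2 * real b)) \<longrightarrow>
        (\<exists>\<epsilon>::real.
          (1 + 1 / real b) ^ k * exp (- real k / real b)
            + (1 - 1 / real b) ^ k * exp (real k / real b) < \<epsilon> \<and>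
          \<epsilon> < 2 * ((1 + 1 / real b) ^ k * exp (- real k / real b)
            + (1 - 1 / real b) ^ k * exp (real k / real b)) \<and>
          bergman_kernel_fun (k + 1) z =
            real k ^ (k + 1) * exp (- real k) / (2 * real b * pi * fact (k - 1)) * (1 + \<epsilon>))))"
proof -
  \<comment> \<open>The space has exponent k + 1 = m + 2, which leaves the power k = m + 1 in the
    series and the factorial of k - 1 = m.\<close>
  define m where "m = k - 1"
  have m: "0 < m" "k = Suc m" "k + 1 = m + 2" "k - 1 = m"
    using assms by (auto simp: m_def)
  have kernel: "bergman_kernel_fun (k + 1) z
      = ln (1 / (cmod z)\<^sup>2) ^ (k + 1) / (2 * pi * fact (k - 1)) * (\<Sum>n. real (Suc n) ^ k * ((cmod z)\<^sup>2) ^ Suc n)"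
    if "0 < cmod z" "cmod z < 1" for z
    using bergman_kernel_fun_eq[OF m(1), of z] that
    unfolding m(3,4) by (simp add: punctured_disc_def log_weight_def m(2) del: power_Suc)
  show ?thesis
  proof (intro conjI allI impI)
    fix z :: complex
    assume z: "0 < cmod z \<and> cmod z \<le> exp (- real k / 2)"
    have "(cmod z)\<^sup>2 \<le> (exp (- real k / 2))\<^sup>2"
      using z by (intro power_mono) auto
    also have "\<dots> = exp (- real k)"
      by (simp add: power2_eq_square mult_exp_exp)
    finally obtain \<epsilon> where \<epsilon>: "0 < \<epsilon>" "\<epsilon> \<le> 2 ^ (k + 1) * (cmod z)\<^sup>2"
      "(\<Sum>n. real (Suc n) ^ k * ((cmod z)\<^sup>2) ^ Suc n) = (cmod z)\<^sup>2 * (1 + \<epsilon>)"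
      using power_series_first_term[of k "(cmod z)\<^sup>2"] assms z by auto
    have "exp (- real k / 2) < 1" using assms by simp
    then have "cmod z < 1" using z by linarith
    then have "bergman_kernel_fun (k + 1) z
        = ln (1 / (cmod z)\<^sup>2) ^ (k + 1) * (cmod z)\<^sup>2 / (2 * pi * fact (k - 1)) * (1 + \<epsilon>)"
      using z by (subst kernel) (simp_all only: \<epsilon>(3) times_divide_eq_left mult.assoc)
    with \<epsilon> show "\<exists>\<epsilon>::real. 0 < \<epsilon> \<and> \<epsilon> \<le> 2 ^ (k + 1) * (cmod z)\<^sup>2 \<and>
          bergman_kernel_fun (k + 1) z =
            ln (1 / (cmod z)\<^sup>2) ^ (k + 1) * (cmod z)\<^sup>2 / (2 * pi * fact (k - 1)) * (1 + \<epsilon>)"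
      by blast
  next
    fix b :: nat and z :: complex
    assume b: "2 \<le> b \<and> ln 2 \<le> real k / (real b * (real b + 1))"
      and z: "cmod z = exp (- real k / (2 * real b))"
    let ?\<delta> = "(1 + 1 / real b) ^ k * exp (- real k / real b) + (1 - 1 / real b) ^ k * exp (real k / real b)"
    have q: "(cmod z)\<^sup>2 = exp (- real k / real b)"
      using b by (simp add: z power2_eq_square mult_exp_exp)
    have L: "ln (1 / (cmod z)\<^sup>2) = real k / real b"
      unfolding q by (simp add: ln_div)
    obtain \<epsilon> where \<epsilon>: "?\<delta> < \<epsilon>" "\<epsilon> < 2 * ?\<delta>"
      "(\<Sum>n. real (Suc n) ^ k * ((cmod z)\<^sup>2) ^ Suc n) = real b ^ k * exp (- real k) * (1 + \<epsilon>)"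
      using power_series_peak_term[of k b] assms b unfolding q by blast
    have "0 < cmod z" "cmod z < 1"
      using z assms b by simp_all
    note kernel[OF this]
    also have "ln (1 / (cmod z)\<^sup>2) ^ (k + 1) / (2 * pi * fact (k - 1)) *
          (\<Sum>n. real (Suc n) ^ k * ((cmod z)\<^sup>2) ^ Suc n)
        = ((real k / real b) ^ (k + 1) * real b ^ k) * (exp (- real k) * (1 + \<epsilon>)) / (2 * pi * fact (k - 1))"
      unfolding L \<epsilon>(3) by (simp add: mult_ac del: power_Suc)
    \<comment> \<open>The logarithm is k/b at this radius and enters with exponent k + 1, against
      b^k in the peak term, so one factor 1/b survives.\<close>
    also have "(real k / real b) ^ (k + 1) * real b ^ k = real k ^ (k + 1) / real b"
      using b by (simp add: power_divide)
    finally have "bergman_kernel_fun (k + 1) z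
        = real k ^ (k + 1) / real b * (exp (- real k) * (1 + \<epsilon>)) / (2 * pi * fact (k - 1))" .
    then have "bergman_kernel_fun (k + 1) z
        = real k ^ (k + 1) * exp (- real k) / (2 * real b * pi * fact (k - 1)) * (1 + \<epsilon>)"
      by (simp add: mult_ac del: power_Suc)
    with \<epsilon>(1,2) show "\<exists>\<epsilon>::real. ?\<delta> < \<epsilon> \<and> \<epsilon> < 2 * ?\<delta> \<and>
          bergman_kernel_fun (k + 1) z =
            real k ^ (k + 1) * exp (- real k) / (2 * real b * pi * fact (k - 1)) * (1 + \<epsilon>)"
      by blast
  qed
qed

end
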